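(* Let $D=d+1\ge 2$ and let $\{P(k_1,\mathbf k)\}_{(k_1,\mathbf k)\in\mathbb R^D}$ be a family of rank-$m$ orthogonal projections on a Hilbert space $\mathcal H$ which is of class $C^1$ (at least), $\mathbb Z^D$-periodic, and time-reversal symmetric with respect to an antiunitary $\theta$ with $\theta^2=\pm\mathbf 1$. Assume that the restriction $\{P(0,\mathbf k)\}_{\mathbf k\in\mathbb R^d}$ admits a smooth, $\mathbb Z^d$-periodic, time-reversal symmetric Bloch frame $\{\xi_a(0,\mathbf k)\}_{a=1}^m$. Let $T_{\mathbf k}(k_1,0)$ be the parallel transport unitary along the segment from $(0,\mathbf k)$ to $(k_1,\mathbf k)$, and define $[\alpha(\mathbf k)]_{ab}:=\langle\xi_a(0,\mathbf k),T_{\mathbf k}(1,0)\xi_b(0,\mathbf k)\rangle$. Then $\alpha$ is a family of matching matrices (with $\varepsilon=\mathbf 1$ if $\theta^2=\mathbf 1$ and $\varepsilon=J$ if $\theta^2=-\mathbf 1$), and $\alpha$ is equivariantly null-homotopic if and only if there exists a Bloch frame for $\{P(k_1,\mathbf k)\}_{(k_1,\mathbf k)\in\mathbb R^D}$ which is continuous, $\mathbb Z^D$-periodic and time-reversal symmetric.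
   Context: A family of projections is time-reversal symmetric w.r.t. an antiunitary $\theta:\mathcal H\to\mathcal H$ if $\theta P(\mathbf q)\theta^{-1}=P(-\mathbf q)$ for all $\mathbf q\in\mathbb R^D$; bosonic if $\theta^2=\mathbf 1$, fermionic if $\theta^2=-\mathbf 1$ (then $m$ is even). A Bloch frame is a collection of maps $\xi_1,\dots,\xi_m:\mathbb R^D\to\mathcal H$ such that $\{\xi_a(\mathbf q)\}$ is an orthonormal basis of $\mathrm{Ran}\,P(\mathbf q)$ for every $\mathbf q$; it is continuous/periodic if each $\xi_a$ is continuous/$\mathbb Z^D$-periodic; it is time-reversal symmetric if $\xi_b(-\mathbf q)=\sum_{a}[\theta\xi_a(\mathbf q)]\varepsilon_{ab}$ for all $b$ and $\mathbf q$, where $\varepsilon=\mathbf 1$ in the bosonic case and $\varepsilon=J=\begin{pmatrix}0&\mathbf 1\\-\mathbf 1&0\end{pmatrix}$ in the fermionic case (same definition for frames of the $d$-dimensional restriction). The parallel transport $T_{\mathbf k}(k_1,0)$ is the unitary solving $\partial_{k_1}T_{\mathbf k}(k_1,0)=[\partial_{k_1}P(k_1,\mathbf k),P(k_1,\mathbf k)]\,T_{\mathbf k}(k_1,0)$, $T_{\mathbf k}(0,0)=\mathbf 1$; it maps $\mathrm{Ran}\,P(0,\mathbf k)$ onto $\mathrm{Ran}\,P(k_1,\mathbf k)$. A family of matching matrices is a continuous, $\mathbb Z^d$-periodic map $\alpha:\mathbb R^d\to U(m)$ with $\varepsilon\alpha(\mathbf k)=\alpha(-\mathbf k)^t\varepsilon$.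 It is equivariantly null-homotopic if there is a map $(t,\mathbf k)\mapsto\alpha_t(\mathbf k)$, continuous in $t\in[0,1]$, each $\alpha_t$ a family of matching matrices, $\alpha_0=\alpha$, $\alpha_1\equiv\mathbf 1$. *)

theory Defs
  imports "HOL-Analysis.Analysis"
begin

text \<open>A complex Hilbert space is represented by its underlying real Hilbert space
(class real_inner + complete_space, whose real inner product is Re of the complex one)
together with the multiplication by the imaginary unit, iunit, which is a real-linear
isometry squaring to minus the identity.\<close>

class chilbert = real_inner + complete_space +
  fixes iunit :: "'a \<Rightarrow> 'a"
  assumes iunit_add: "iunit (x + y) = iunit x + iunit y"
    and iunit_scaleR: "iunit (r *\<^sub>R x) = r *\<^sub>R iunit x"
    and iunit_iunit: "iunit (iunit x) = - x"
    and iunit_inner: "inner (iunit x) (iunit y) = inner x y"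

instantiation complex :: chilbert
begin
definition iunit_complex :: "complex \<Rightarrow> complex" where "iunit_complex z = \<i> * z"
instance
  by standard (auto simp: iunit_complex_def algebra_simps inner_complex_def scaleR_conv_of_real)
end

text \<open>Complex scalar multiplication and the complex inner product
(linear in the second argument, antilinear in the first).\<close>

definition scaleC :: "complex \<Rightarrow> 'h::chilbert \<Rightarrow> 'h" where
  "scaleC c x = Re c *\<^sub>R x + Im c *\<^sub>R iunit x"

definition cinner :: "'h::chilbert \<Rightarrow> 'h \<Rightarrow> complex" where
  "cinner x y = complex_of_real (inner x y) - \<i> * complex_of_real (inner x (iunit y))"

definition clinear_op :: "('h::chilbert \<Rightarrow>\<^sub>L 'h) \<Rightarrow> bool" where
  "clinear_op A \<longleftrightarrow> (\<forall>x. blinfun_apply A (iunit x) = iunit (blinfun_apply A x))"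

definition orth_proj :: "('h::chilbert \<Rightarrow>\<^sub>L 'h) \<Rightarrow> bool" where
  "orth_proj A \<longleftrightarrow> clinear_op A
     \<and> (\<forall>x. blinfun_apply A (blinfun_apply A x) = blinfun_apply A x)
     \<and> (\<forall>x y. cinner (blinfun_apply A x) y = cinner x (blinfun_apply A y))"

definition onb_of_range :: "('h::chilbert \<Rightarrow>\<^sub>L 'h) \<Rightarrow> nat \<Rightarrow> (nat \<Rightarrow> 'h) \<Rightarrow> bool" where
  "onb_of_range A m e \<longleftrightarrow>
     (\<forall>a<m. \<forall>b<m. cinner (e a) (e b) = (if a = b then 1 else 0))
     \<and> range (blinfun_apply A) = {(\<Sum>a<m. scaleC (c a) (e a)) | c. True}"

definition rank_proj :: "('h::chilbert \<Rightarrow>\<^sub>L 'h) \<Rightarrow> nat \<Rightarrow> bool" where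
  "rank_proj A m \<longleftrightarrow> orth_proj A \<and> (\<exists>e. onb_of_range A m e)"

definition antiunitary :: "('h::chilbert \<Rightarrow> 'h) \<Rightarrow> bool" where
  "antiunitary \<theta> \<longleftrightarrow> bij \<theta>
     \<and> (\<forall>x y. \<theta> (x + y) = \<theta> x + \<theta> y)
     \<and> (\<forall>c x. \<theta> (scaleC c x) = scaleC (cnj c) (\<theta> x))
     \<and> (\<forall>x y. cinner (\<theta> x) (\<theta> y) = cinner y x)"

definition int_vec :: "real^'d \<Rightarrow> bool" where
  "int_vec n \<longleftrightarrow> (\<forall>i. n $ i \<in> \<int>)"

definition periodic_d :: "(real^'d \<Rightarrow> 'b) \<Rightarrow> bool" where
  "periodic_d f \<longleftrightarrow> (\<forall>k n. int_vec n \<longrightarrow> f (k + n) = f k)"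

definition periodic_D :: "((real \<times> (real^'d)) \<Rightarrow> 'b) \<Rightarrow> bool" where
  "periodic_D f \<longleftrightarrow> (\<forall>q n1 n. n1 \<in> \<int> \<and> int_vec n \<longrightarrow> f (q + (n1, n)) = f q)"

definition dir_deriv :: "('a::real_normed_vector \<Rightarrow> 'b::real_normed_vector) \<Rightarrow> 'a \<Rightarrow> 'a \<Rightarrow> 'b" where
  "dir_deriv f v x = vector_derivative (\<lambda>t. f (x + t *\<^sub>R v)) (at 0)"

fun iter_dir_deriv :: "('a::real_normed_vector \<Rightarrow> 'b::real_normed_vector) \<Rightarrow> 'a list \<Rightarrow> 'a \<Rightarrow> 'b" where
  "iter_dir_deriv f [] = f"
| "iter_dir_deriv f (v # vs) = dir_deriv (iter_dir_deriv f vs) v"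

definition smooth_map :: "('a::euclidean_space \<Rightarrow> 'b::real_normed_vector) \<Rightarrow> bool" where
  "smooth_map f \<longleftrightarrow> (\<forall>vs. continuous_on UNIV (iter_dir_deriv f vs)
       \<and> (\<forall>v x. (\<lambda>t. iter_dir_deriv f vs (x + t *\<^sub>R v)) differentiable (at 0)))"

definition bloch_frame :: "('q \<Rightarrow> ('h::chilbert \<Rightarrow>\<^sub>L 'h)) \<Rightarrow> nat \<Rightarrow> (nat \<Rightarrow> 'q \<Rightarrow> 'h) \<Rightarrow> bool" where
  "bloch_frame Q m \<xi> \<longleftrightarrow> (\<forall>q. onb_of_range (Q q) m (\<lambda>a. \<xi> a q))"

definition frame_continuous :: "nat \<Rightarrow> (nat \<Rightarrow> 'q::topological_space \<Rightarrow> 'h::chilbert) \<Rightarrow> bool" where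
  "frame_continuous m \<xi> \<longleftrightarrow> (\<forall>a<m. continuous_on UNIV (\<xi> a))"

text \<open>The matrix epsilon: identity (bosonic) or J = [[0,1],[-1,0]] in m/2 blocks (fermionic).\<close>
definition eps_mat :: "bool \<Rightarrow> nat \<Rightarrow> nat \<Rightarrow> nat \<Rightarrow> complex" where
  "eps_mat ferm m a b =
     (if \<not> ferm then (if a = b then 1 else 0)
      else if a < m div 2 \<and> b = a + m div 2 then 1
      else if m div 2 \<le> a \<and> a < m \<and> a = b + m div 2 then -1
      else 0)"

definition fermionic :: "('h::chilbert \<Rightarrow> 'h) \<Rightarrow> bool" where
  "fermionic \<theta> \<longleftrightarrow> (\<forall>x. \<theta> (\<theta> x) = - x)"

definition trs_frame :: "('h::chilbert \<Rightarrow> 'h) \<Rightarrow> nat \<Rightarrow> (nat \<Rightarrow> 'q::uminus \<Rightarrow> 'h) \<Rightarrow> bool" where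
  "trs_frame \<theta> m \<xi> \<longleftrightarrow> (\<forall>b<m. \<forall>q. \<xi> b (- q) =
      (\<Sum>a<m. scaleC (eps_mat (fermionic \<theta>) m a b) (\<theta> (\<xi> a q))))"

text \<open>m x m matrices are functions nat => nat => complex, only entries a, b < m matter.\<close>
definition unitary_mat :: "nat \<Rightarrow> (nat \<Rightarrow> nat \<Rightarrow> complex) \<Rightarrow> bool" where
  "unitary_mat m A \<longleftrightarrow> (\<forall>a<m. \<forall>b<m. (\<Sum>c<m. cnj (A c a) * A c b) = (if a = b then 1 else 0))"

definition matching_family :: "(nat \<Rightarrow> nat \<Rightarrow> complex) \<Rightarrow> nat \<Rightarrow> (real^'d \<Rightarrow> nat \<Rightarrow> nat \<Rightarrow> complex) \<Rightarrow> bool" where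
  "matching_family \<epsilon> m \<alpha> \<longleftrightarrow>
     (\<forall>a<m. \<forall>b<m. continuous_on UNIV (\<lambda>k. \<alpha> k a b))
     \<and> (\<forall>a<m. \<forall>b<m. periodic_d (\<lambda>k. \<alpha> k a b))
     \<and> (\<forall>k. unitary_mat m (\<alpha> k))
     \<and> (\<forall>k. \<forall>a<m. \<forall>b<m. (\<Sum>c<m. \<epsilon> a c * \<alpha> k c b) = (\<Sum>c<m. \<alpha> (- k) c a * \<epsilon> c b))"

definition equiv_null_homotopic :: "(nat \<Rightarrow> nat \<Rightarrow> complex) \<Rightarrow> nat \<Rightarrow> (real^'d \<Rightarrow> nat \<Rightarrow> nat \<Rightarrow> complex) \<Rightarrow> bool" where
  "equiv_null_homotopic \<epsilon> m \<alpha> \<longleftrightarrow> (\<exists>H :: real \<Rightarrow> real^'d \<Rightarrow> nat \<Rightarrow> nat \<Rightarrow> complex.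
     (\<forall>a<m. \<forall>b<m. continuous_on ({0..1} \<times> UNIV) (\<lambda>(t, k). H t k a b))
     \<and> (\<forall>t\<in>{0..1}. matching_family \<epsilon> m (H t))
     \<and> (\<forall>k. \<forall>a<m. \<forall>b<m. H 0 k a b = \<alpha> k a b \<and> H 1 k a b = (if a = b then 1 else 0)))"

end

(* Parallel transport T identifies frames over k_1 = 0 with frames over every k_1, and a
   time-reversal symmetric frame is determined by its values for 0 <= k_1 <= 1/2; the only obstruction
   to gluing sits at k_1 = 1/2.

   Given a symmetric frame Xi, comparing the parallel frames at -u and u with Xi(-u, .) and Xi(u, .)
   yields, for 0 <= u <= 1/2, a path of matching matrices from the identity to alpha.

   Conversely, a null-homotopy becomes a path V_t of unitaries on the Hilbert space with V_0 = 1,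
   V_1 = T(1, 0) on Ran P(0, k) and V_t(k) theta V_t(-k) theta^-1 = 1.  One needs delta with
   V_1(k) delta(k) = theta delta(-k) theta^-1: this is a path-lifting problem, solved in small steps,
   each of which corrects delta by the square root of a unitary close to the identity.  The frame is then
   T(k_1, 0) delta_{2 k_1} xi on [0, 1/2], extended by time reversal and periodicity. *)
theory Submission
  imports Defs
begin

section \<open>Complex Hilbert spaces\<close>

text \<open>A continuous symmetric square root of the end of the path would solve the lifting
  problem at once, but the eigenvalues may pass through -1, where the usual branch of the root
  breaks. Near the identity the root is unique, so it inherits every symmetry of its argument:
  periodicity, commutation with \<open>iunit\<close> and \<open>P (0, k)\<close>, behaviour under
  \<theta>. Existence, uniqueness and Lipschitz dependence all come from norm estimates in the ball
  of radius 1/2 about the identity. Compactness of the time interval times the unit cell bounds the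
  number of steps.

  Operators on the Hilbert space are used instead of matrices because \<theta> then becomes a
  real-linear isometry by which one can conjugate. The two signs of its square are treated together,
  since in the lifting argument only the centrality of that square enters. The price of infinite
  dimension is that isometries need not be invertible, so inverses are carried along.

  The gluing at k_1 = 1/2 rests on T(1/2, 0) = T(-1/2, 0) T(1, 0), a consequence of the periodicity
  of the generator.\<close>

lemma iunit_minus [simp]: "iunit (- x) = - iunit x" for x :: "'h::chilbert"
  using iunit_scaleR[of "-1" x] by simp

lemma iunit_diff: "iunit (x - y) = iunit x - iunit y" for x y :: "'h::chilbert"
  using iunit_add[of x "- y"] by simp

lemma norm_iunit [simp]: "norm (iunit x) = norm x" for x :: "'h::chilbert"
  by (simp add: norm_eq_sqrt_inner iunit_inner)

lemma inner_iunit_left: "inner (iunit x) y = - inner x (iunit y)" for x y :: "'h::chilbert"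
  using iunit_inner[of "iunit x" y] by (simp add: iunit_iunit)

lemma inner_iunit_self [simp]: "inner x (iunit x) = 0" for x :: "'h::chilbert"
  using inner_iunit_left[of x x] by (simp add: inner_commute)

lemma bounded_linear_iunit: "bounded_linear (iunit :: 'h::chilbert \<Rightarrow> 'h)"
  by (rule bounded_linear_intro[where K=1]) (auto simp: iunit_add iunit_scaleR)

lift_definition iunit_blinfun :: "'h::chilbert \<Rightarrow>\<^sub>L 'h" is iunit
  by (rule bounded_linear_iunit)

declare iunit_blinfun.rep_eq [simp]

text \<open>Over the reals, \<open>bounded_bilinear\<close> supplies sums, limits and continuity.
  The constant 2 comes from estimating real and imaginary parts separately.\<close>

lemma bounded_bilinear_scaleC: "bounded_bilinear (scaleC :: complex \<Rightarrow> 'h::chilbert \<Rightarrow> 'h)"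
proof
  show "\<exists>K. \<forall>a b. norm (scaleC a (b::'h)) \<le> norm a * norm b * K"
  proof (intro exI allI)
    fix a :: complex and b :: 'h
    have "norm (scaleC a b) \<le> \<bar>Re a\<bar> * norm b + \<bar>Im a\<bar> * norm b"
      unfolding scaleC_def by (rule norm_triangle_le) simp
    also have "\<dots> \<le> norm a * norm b + norm a * norm b"
      by (intro add_mono mult_right_mono abs_Re_le_cmod abs_Im_le_cmod) auto
    finally show "norm (scaleC a b) \<le> norm a * norm b * 2" by (simp add: ac_simps)
  qed
qed (auto simp: scaleC_def algebra_simps iunit_add iunit_scaleR)

interpretation scaleC: bounded_bilinear "scaleC :: complex \<Rightarrow> 'h::chilbert \<Rightarrow> 'h"
  by (rule bounded_bilinear_scaleC)

lemma scaleC_one [simp]: "scaleC 1 x = x"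
  by (simp add: scaleC_def)

lemma scaleC_scaleC [simp]: "scaleC a (scaleC b x) = scaleC (a * b) x"
  by (simp add: scaleC_def iunit_add iunit_scaleR iunit_iunit algebra_simps)

lemma scaleC_of_real: "scaleC (complex_of_real r) x = r *\<^sub>R x"
  by (simp add: scaleC_def)

lemma bounded_bilinear_cinner: "bounded_bilinear (cinner :: 'h::chilbert \<Rightarrow> 'h \<Rightarrow> complex)"
proof
  show "\<exists>K. \<forall>a b. norm (cinner a (b::'h)) \<le> norm a * norm b * K"
  proof (intro exI allI)
    fix a b :: 'h
    have "norm (cinner a b) \<le> \<bar>inner a b\<bar> + \<bar>inner a (iunit b)\<bar>"
      unfolding cinner_def by (rule norm_triangle_le_diff) (simp add: norm_mult)
    also have "\<dots> \<le> norm a * norm b + norm a * norm b"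
      using Cauchy_Schwarz_ineq2[of a b] Cauchy_Schwarz_ineq2[of a "iunit b"] by simp
    finally show "norm (cinner a b) \<le> norm a * norm b * 2" by (simp add: ac_simps)
  qed
qed (auto simp: cinner_def inner_add_left inner_add_right algebra_simps iunit_add iunit_scaleR scaleR_conv_of_real)

interpretation cinner: bounded_bilinear "cinner :: 'h::chilbert \<Rightarrow> 'h \<Rightarrow> complex"
  by (rule bounded_bilinear_cinner)

lemma cinner_iunit_right: "cinner x (iunit y) = \<i> * cinner x y"
  by (simp add: cinner_def iunit_iunit algebra_simps)

lemma cnj_cinner: "cnj (cinner x y) = cinner y x"
  using inner_iunit_left[of x y] by (simp add: cinner_def inner_commute)

lemma cinner_scaleC_right [simp]: "cinner x (scaleC c y) = c * cinner x y"
  by (simp add: scaleC_def cinner.add_right cinner.scaleR_right cinner_iunit_right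
      complex_eq_iff algebra_simps)

lemma cinner_scaleC_left [simp]: "cinner (scaleC c x) y = cnj c * cinner x y"
  by (metis cinner_scaleC_right cnj_cinner complex_cnj_mult)

lemma cinner_self: "cinner x x = complex_of_real ((norm x)\<^sup>2)"
  by (simp add: cinner_def power2_norm_eq_inner)

lemma cinner_mult_self: "cinner x y * cinner y x = complex_of_real ((cmod (cinner x y))\<^sup>2)"
  by (metis cnj_cinner complex_norm_square)

lemma norm_cinner_commute: "cmod (cinner x y) = cmod (cinner y x)"
  by (metis cnj_cinner complex_mod_cnj)

lemma Re_cinner [simp]: "Re (cinner x y) = inner x y"
  by (simp add: cinner_def)

subsection \<open>Orthonormal bases of ranges of projections\<close>

definition orthonormal :: "nat \<Rightarrow> (nat \<Rightarrow> 'h::chilbert) \<Rightarrow> bool" where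
  "orthonormal m e \<longleftrightarrow> (\<forall>a<m. \<forall>b<m. cinner (e a) (e b) = (if a = b then 1 else 0))"

lemma orthonormalD: "orthonormal m e \<Longrightarrow> a < m \<Longrightarrow> b < m \<Longrightarrow> cinner (e a) (e b) = (if a = b then 1 else 0)"
  by (simp add: orthonormal_def)

lemma cinner_orthonormal_sum:
  assumes "orthonormal m e" "b < m"
  shows "cinner (e b) (\<Sum>a<m. scaleC (c a) (e a)) = c b"
proof -
  have "cinner (e b) (\<Sum>a<m. scaleC (c a) (e a)) = (\<Sum>a<m. c a * cinner (e b) (e a))"
    by (simp add: cinner.sum_right)
  also have "\<dots> = (\<Sum>a<m. if a = b then c a else 0)"
    by (rule sum.cong) (use assms in \<open>auto simp: orthonormal_def\<close>)
  finally show ?thesis using assms by simp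
qed

lemma orth_projD:
  assumes "orth_proj A"
  shows "A (iunit x) = iunit (A x)" "A (A x) = A x" "cinner (A x) y = cinner x (A y)"
    "inner (A x) y = inner x (A y)"
proof -
  show 1: "A (iunit x) = iunit (A x)" "A (A x) = A x" "cinner (A x) y = cinner x (A y)"
    using assms by (auto simp: orth_proj_def clinear_op_def)
  show "inner (A x) y = inner x (A y)" using 1(3) by (metis Re_cinner)
qed

text \<open>The range condition makes each \<open>e a\<close> a fixed point of the idempotent
  \<open>A\<close>; moving \<open>A\<close> across the inner product then identifies the
  coefficients of \<open>A x\<close>.\<close>

lemma onb_of_rangeD:
  assumes "orth_proj A" "onb_of_range A m e"
  shows "orthonormal m e" "a < m \<Longrightarrow> A (e a) = e a"
    "A x = (\<Sum>a<m. scaleC (cinner (e a) x) (e a))"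
proof -
  show on: "orthonormal m e" using assms(2) by (simp add: onb_of_range_def orthonormal_def)
  have rg: "range (blinfun_apply A) = {(\<Sum>a<m. scaleC (c a) (e a)) | c. True}"
    using assms(2) by (simp add: onb_of_range_def)
  have fx: "A (e a) = e a" if "a < m" for a
  proof -
    have "(\<Sum>b<m. scaleC (if b = a then 1 else 0) (e b)) = (\<Sum>b<m. if b = a then e b else 0)"
      by (rule sum.cong) (auto simp: scaleC.zero_left)
    then have "(\<Sum>b<m. scaleC (if b = a then 1 else 0) (e b)) = e a" using that by simp
    then have "e a \<in> range (blinfun_apply A)" unfolding rg
      by (intro CollectI exI[of _ "\<lambda>b. if b = a then 1 else 0"]) simp
    then show ?thesis using orth_projD(2)[OF assms(1)] by auto
  qed
  then show "a < m \<Longrightarrow> A (e a) = e a" .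
  obtain c where c: "A x = (\<Sum>a<m. scaleC (c a) (e a))" using rg by blast
  have "c a = cinner (e a) x" if "a < m" for a
    using cinner_orthonormal_sum[OF on that, of c] c orth_projD(3)[OF assms(1), of "e a" x] fx[OF that]
    by simp
  then show "A x = (\<Sum>a<m. scaleC (cinner (e a) x) (e a))" using c by simp
qed

lemma onb_parseval:
  assumes "orth_proj A" "onb_of_range A m e" "A y = y"
  shows "cinner x y = (\<Sum>c<m. cinner x (e c) * cinner (e c) y)"
  using onb_of_rangeD(3)[OF assms(1,2), of y] assms(3)
  by (metis (no_types, lifting) cinner.sum_right cinner_scaleC_right mult.commute sum.cong)

lemma bessel_defect:
  assumes "orthonormal m e"
  shows "(norm (f - (\<Sum>a<m. scaleC (cinner (e a) f) (e a))))\<^sup>2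
    = (norm f)\<^sup>2 - (\<Sum>a<m. (cmod (cinner (e a) f))\<^sup>2)"
proof -
  let ?s = "\<Sum>a<m. scaleC (cinner (e a) f) (e a)"
  have 1: "cinner ?s f = (\<Sum>a<m. complex_of_real ((cmod (cinner (e a) f))\<^sup>2))"
    by (simp only: cinner.sum_left cinner_scaleC_left cnj_cinner cinner_mult_self norm_cinner_commute[of f])
  have 2: "cinner ?s ?s = cinner ?s f"
    unfolding cinner.sum_left
    by (rule sum.cong) (auto simp: cinner_orthonormal_sum[OF assms])
  have 3: "cinner f ?s = cinner ?s f" using 1 cnj_cinner[of ?s f] by simp
  have "complex_of_real ((norm (f - ?s))\<^sup>2) = cinner f f - cinner ?s f"
    unfolding cinner_self[symmetric] by (simp add: cinner.diff_left cinner.diff_right 2 3)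
  also have "\<dots> = complex_of_real ((norm f)\<^sup>2 - (\<Sum>a<m. (cmod (cinner (e a) f))\<^sup>2))"
    by (simp add: 1 cinner_self)
  finally show ?thesis by (simp only: of_real_eq_iff)
qed

text \<open>Summing the Bessel inequalities of an orthonormal basis with respect to \<open>e\<close> and counting
  the double sum in both orders gives \<open>m \<le> m\<close>, so all of them are equalities.\<close>
lemma onb_of_rangeI:
  assumes A: "orth_proj A" and f: "onb_of_range A m f" and e: "orthonormal m e"
    and fx: "\<And>a. a < m \<Longrightarrow> A (e a) = e a"
  shows "onb_of_range A m e"
proof -
  note on = onb_of_rangeD(1)[OF A f]
  have nrm: "(norm (g a))\<^sup>2 = 1" if "orthonormal m g" "a < m" for g :: "nat \<Rightarrow> 'a" and a
    using orthonormalD[OF that(1) that(2) that(2)] cinner_self[of "g a"]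
    by (metis of_real_eq_1_iff)
  define d where "d b = (norm (f b - (\<Sum>a<m. scaleC (cinner (e a) (f b)) (e a))))\<^sup>2" for b
  have "(\<Sum>b<m. d b) = (\<Sum>b<m. 1 - (\<Sum>a<m. (cmod (cinner (e a) (f b)))\<^sup>2))"
    by (rule sum.cong) (auto simp: d_def bessel_defect[OF e] nrm[OF on])
  also have "\<dots> = real m - (\<Sum>a<m. \<Sum>b<m. (cmod (cinner (e a) (f b)))\<^sup>2)"
    by (simp add: sum_subtractf) (rule sum.swap)
  also have "(\<Sum>a<m. \<Sum>b<m. (cmod (cinner (e a) (f b)))\<^sup>2) = (\<Sum>a<m. 1)"
  proof (rule sum.cong)
    fix a assume "a \<in> {..<m}"
    then have a: "a < m" by simp
    have "complex_of_real (\<Sum>b<m. (cmod (cinner (e a) (f b)))\<^sup>2) = cinner (e a) (e a)"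
      unfolding onb_parseval[OF A f fx[OF a], of "e a"] by (simp only: of_real_sum cinner_mult_self)
    also have "\<dots> = 1" using orthonormalD[OF e a a] by simp
    finally show "(\<Sum>b<m. (cmod (cinner (e a) (f b)))\<^sup>2) = 1" by (simp only: of_real_eq_1_iff)
  qed simp
  finally have "(\<Sum>b<m. d b) = 0" by simp
  then have "\<forall>b\<in>{..<m}. d b = 0"
    by (subst (asm) sum_nonneg_eq_0_iff) (auto simp: d_def)
  then have fb: "f b = (\<Sum>a<m. scaleC (cinner (e a) (f b)) (e a))" if "b < m" for b
    using that by (auto simp: d_def)
  have "A x \<in> {(\<Sum>a<m. scaleC (c a) (e a)) | c. True}" for x
  proof -
    have "A x = (\<Sum>b<m. scaleC (cinner (f b) x) (f b))" by (rule onb_of_rangeD(3)[OF A f])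
    also have "\<dots> = (\<Sum>b<m. \<Sum>a<m. scaleC (cinner (f b) x * cinner (e a) (f b)) (e a))"
      by (rule sum.cong[OF refl], subst fb) (auto simp: scaleC.sum_right)
    also have "\<dots> = (\<Sum>a<m. scaleC (\<Sum>b<m. cinner (f b) x * cinner (e a) (f b)) (e a))"
      by (subst sum.swap) (simp add: scaleC.sum_left)
    finally show ?thesis by (intro CollectI exI conjI TrueI)
  qed
  moreover have "A (\<Sum>a<m. scaleC (c a) (e a)) = (\<Sum>a<m. scaleC (c a) (e a))" for c
    using fx orth_projD(1)[OF A]
    by (auto simp: blinfun.sum_right scaleC_def blinfun.add_right blinfun.scaleR_right intro!: sum.cong)
  ultimately show ?thesis using e
    unfolding onb_of_range_def orthonormal_def by (auto simp: image_iff) metis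
qed

section \<open>Square roots of operators close to the identity\<close>

lemma blinfun_isometry_inner:
  fixes A :: "'a::real_inner \<Rightarrow>\<^sub>L 'b::real_inner"
  assumes "\<And>x. norm (A x) = norm x"
  shows "inner (A x) (A y) = inner x y"
  using assms[of "x + y"] by (simp add: dot_norm assms blinfun.add_right)

lemma norm_compose_le:
  assumes "norm A \<le> a" "norm B \<le> b"
  shows "norm (A o\<^sub>L B) \<le> a * norm B" "norm (A o\<^sub>L B) \<le> norm A * b" "norm (A o\<^sub>L B) \<le> a * b"
  by (rule order_trans[OF norm_blinfun_compose];
      use assms in \<open>auto intro!: mult_mono order_trans[OF norm_ge_zero assms(1)]\<close>)+

text \<open>With D = S1 - S2, the difference of the squares is 2 D + (S1 - 1) D + D (S2 - 1). The
  two corrections cost at most half of the norm of D each, so one copy of that norm survives.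
  Uniqueness of the root and its Lipschitz dependence are both this estimate.\<close>

lemma norm_sqrt_diff_le:
  fixes S1 S2 :: "'a::real_normed_vector \<Rightarrow>\<^sub>L 'a"
  assumes "norm (S1 - id_blinfun) \<le> 1/2" "norm (S2 - id_blinfun) \<le> 1/2"
  shows "norm (S1 - S2) \<le> norm ((S1 o\<^sub>L S1) - (S2 o\<^sub>L S2))"
proof -
  let ?D = "S1 - S2" and ?A = "(S1 - id_blinfun) o\<^sub>L (S1 - S2)" and ?B = "(S1 - S2) o\<^sub>L (S2 - id_blinfun)"
  have "2 *\<^sub>R ?D = ((S1 o\<^sub>L S1) - (S2 o\<^sub>L S2)) - (?A + ?B)"
    by (rule blinfun_eqI) (simp add: blinfun.bilinear_simps scaleR_2)
  then have "2 * norm ?D = norm (((S1 o\<^sub>L S1) - (S2 o\<^sub>L S2)) - (?A + ?B))"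
    by (metis norm_scaleR abs_numeral)
  also have "\<dots> \<le> norm ((S1 o\<^sub>L S1) - (S2 o\<^sub>L S2)) + (norm ?A + norm ?B)"
    by (intro norm_triangle_le_diff add_mono norm_triangle_ineq order_refl)
  also have "norm ?A \<le> 1/2 * norm ?D" by (rule norm_compose_le(1)[OF assms(1) order_refl])
  also have "norm ?B \<le> norm ?D * (1/2)" by (rule norm_compose_le(2)[OF order_refl assms(2)])
  finally show ?thesis by simp
qed

text \<open>Writing S = 1 + Y turns S S = D into the fixed point equation Y = (D - 1 - Y Y) / 2. On
  the ball of radius 1/2 the right side has norm at most 3/8 and contracts by 1/2.\<close>

lemma sqrt_exists:
  fixes D :: "'a::banach \<Rightarrow>\<^sub>L 'a"
  assumes D: "norm (D - id_blinfun) \<le> 1/2"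
  shows "\<exists>S. norm (S - id_blinfun) \<le> 1/2 \<and> S o\<^sub>L S = D"
proof -
  define f where "f Y = (1/2) *\<^sub>R (D - id_blinfun - (Y o\<^sub>L Y))" for Y :: "'a \<Rightarrow>\<^sub>L 'a"
  have "\<exists>!Y. Y \<in> cball 0 (1/2) \<and> f Y = Y"
  proof (rule Banach_fix[where c = "1/2"])
    show "f ` cball 0 (1/2) \<subseteq> cball 0 (1/2)"
    proof safe
      fix Y :: "'a \<Rightarrow>\<^sub>L 'a" assume "Y \<in> cball 0 (1/2)"
      then have Y: "norm Y \<le> 1/2" by (simp add: dist_norm)
      have "norm (D - id_blinfun - (Y o\<^sub>L Y)) \<le> 1/2 + 1/2 * (1/2)"
        by (rule order_trans[OF norm_triangle_ineq4 add_mono[OF D norm_compose_le(3)[OF Y Y]]])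
      then show "f Y \<in> cball 0 (1/2)" by (simp add: f_def dist_norm)
    qed
    show "dist (f Y) (f Z) \<le> 1/2 * dist Y Z" if "Y \<in> cball 0 (1/2)" "Z \<in> cball 0 (1/2)" for Y Z
    proof -
      have YZ: "norm Y \<le> 1/2" "norm Z \<le> 1/2" using that by (simp_all add: dist_norm)
      have "f Y - f Z = (1/2) *\<^sub>R ((Y o\<^sub>L (Z - Y)) + ((Z - Y) o\<^sub>L Z))"
        by (rule blinfun_eqI) (simp add: f_def blinfun.bilinear_simps algebra_simps)
      then have "norm (f Y - f Z) = 1/2 * norm ((Y o\<^sub>L (Z - Y)) + ((Z - Y) o\<^sub>L Z))"
        by simp
      also have "\<dots> \<le> 1/2 * (1/2 * norm (Z - Y) + norm (Z - Y) * (1/2))"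
        by (intro mult_left_mono order_trans[OF norm_triangle_ineq] add_mono
            norm_compose_le(1)[OF YZ(1) order_refl] norm_compose_le(2)[OF order_refl YZ(2)]) simp
      finally show ?thesis by (simp add: dist_norm norm_minus_commute)
    qed
  qed (auto intro: complete_closed_subset)
  then obtain Y where Y: "Y \<in> cball 0 (1/2)" "f Y = Y" by blast
  have "(id_blinfun + Y) o\<^sub>L (id_blinfun + Y) = D"
  proof (rule blinfun_eqI)
    fix x
    have "2 *\<^sub>R Y x = 2 *\<^sub>R f Y x" using Y(2) by simp
    also have "\<dots> = D x - x - Y (Y x)" by (simp add: f_def blinfun.bilinear_simps)
    finally show "((id_blinfun + Y) o\<^sub>L (id_blinfun + Y)) x = D x"
      by (simp add: blinfun.bilinear_simps scaleR_2 algebra_simps)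
  qed
  then show ?thesis using Y(1) by (intro exI[of _ "id_blinfun + Y"]) (simp add: dist_norm)
qed

text \<open>At most one root lies within distance 1/2 of the identity, so the choice is canonical
  wherever \<open>D\<close> itself is that close.\<close>

definition near_sqrt :: "('a::real_normed_vector \<Rightarrow>\<^sub>L 'a) \<Rightarrow> 'a \<Rightarrow>\<^sub>L 'a" where
  "near_sqrt D = (SOME S. norm (S - id_blinfun) \<le> 1/2 \<and> S o\<^sub>L S = D)"

lemma near_sqrt:
  fixes D :: "'a::banach \<Rightarrow>\<^sub>L 'a"
  assumes "norm (D - id_blinfun) \<le> 1/2"
  shows "norm (near_sqrt D - id_blinfun) \<le> 1/2" "near_sqrt D o\<^sub>L near_sqrt D = D"
  using someI_ex[OF sqrt_exists[OF assms]] by (simp_all add: near_sqrt_def)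

lemma near_sqrt_lipschitz:
  fixes D E :: "'a::banach \<Rightarrow>\<^sub>L 'a"
  assumes "norm (D - id_blinfun) \<le> 1/2" "norm (E - id_blinfun) \<le> 1/2"
  shows "norm (near_sqrt D - near_sqrt E) \<le> norm (D - E)"
  using norm_sqrt_diff_le[OF near_sqrt(1)[OF assms(1)] near_sqrt(1)[OF assms(2)]]
  unfolding near_sqrt(2)[OF assms(1)] near_sqrt(2)[OF assms(2)] .

lemma near_sqrt_unique:
  fixes D :: "'a::banach \<Rightarrow>\<^sub>L 'a"
  assumes "norm (D - id_blinfun) \<le> 1/2" "norm (S - id_blinfun) \<le> 1/2" "S o\<^sub>L S = D"
  shows "near_sqrt D = S"
  using norm_sqrt_diff_le[OF near_sqrt(1)[OF assms(1)] assms(2)]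
  unfolding near_sqrt(2)[OF assms(1)] assms(3) by simp

lemma continuous_on_near_sqrt:
  fixes D :: "'t::topological_space \<Rightarrow> 'a::banach \<Rightarrow>\<^sub>L 'a"
  assumes "continuous_on A D" "\<And>x. x \<in> A \<Longrightarrow> norm (D x - id_blinfun) \<le> 1/2"
  shows "continuous_on A (\<lambda>x. near_sqrt (D x))"
proof -
  have "continuous_on {E. norm (E - id_blinfun) \<le> 1/2} (near_sqrt :: ('a \<Rightarrow>\<^sub>L 'a) \<Rightarrow> _)"
    unfolding continuous_on_iff dist_norm
    by (blast intro: order.strict_trans1[OF near_sqrt_lipschitz])
  then show ?thesis
    by (rule continuous_on_compose2[OF _ assms(1)]) (use assms(2) in auto)
qed

text \<open>The conjugated root is a root of the conjugated operator and, as \<open>Q\<close> and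
  \<open>R\<close> are contractions, stays in the ball of uniqueness. A conjugation that fixes
  \<open>D\<close> thus fixes its root, which is how symmetries pass to roots.\<close>

lemma near_sqrt_conjugate:
  fixes D :: "'a::banach \<Rightarrow>\<^sub>L 'a"
  assumes D: "norm (D - id_blinfun) \<le> 1/2"
    and Q: "(Q :: 'a \<Rightarrow>\<^sub>L 'a) o\<^sub>L R = id_blinfun" "R o\<^sub>L Q = id_blinfun" "norm Q \<le> 1" "norm R \<le> 1"
  shows "near_sqrt (Q o\<^sub>L D o\<^sub>L R) = Q o\<^sub>L near_sqrt D o\<^sub>L R"
proof -
  have QR: "Q (R x) = x" "R (Q x) = x" for x
    using Q(1,2) by (metis blinfun_apply_blinfun_compose blinfun_apply_id_blinfun)+
  have nrm: "norm ((Q o\<^sub>L S o\<^sub>L R) - id_blinfun) \<le> norm (S - id_blinfun)" for S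
  proof -
    have "(Q o\<^sub>L S o\<^sub>L R) - id_blinfun = Q o\<^sub>L (S - id_blinfun) o\<^sub>L R"
      by (rule blinfun_eqI) (simp add: blinfun.bilinear_simps QR)
    moreover have "norm \<dots> \<le> 1 * norm (S - id_blinfun) * 1"
      by (intro norm_compose_le(3) norm_compose_le(1)[OF Q(3) order_refl] Q(4))
    ultimately show ?thesis by simp
  qed
  show ?thesis
  proof (rule near_sqrt_unique)
    show "(Q o\<^sub>L near_sqrt D o\<^sub>L R) o\<^sub>L (Q o\<^sub>L near_sqrt D o\<^sub>L R) = Q o\<^sub>L D o\<^sub>L R"
      by (rule blinfun_eqI)
        (simp add: QR near_sqrt(2)[OF D, THEN arg_cong, of "\<lambda>A. blinfun_apply A _", simplified])
  qed (use nrm order_trans D near_sqrt(1)[OF D] in blast)+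
qed

text \<open>The form \<open>F x y = \<langle>S x, S y\<rangle> - \<langle>x, y\<rangle>\<close> satisfies \<open>F (S x) (S y) = - F x y\<close>; expanding
  \<open>S = 1 + Y\<close> with \<open>\<parallel>Y\<parallel> \<le> 1/2\<close> shows that any bound on \<open>F\<close> improves by the factor \<open>5/8\<close>.\<close>
lemma near_sqrt_isometry:
  fixes D :: "'a::{real_inner,banach} \<Rightarrow>\<^sub>L 'a"
  assumes D: "norm (D - id_blinfun) \<le> 1/2" and iso: "\<And>x. norm (D x) = norm x"
  shows "norm (near_sqrt D x) = norm x"
proof -
  define S where "S = near_sqrt D"
  define Y where "Y = S - id_blinfun"
  have Sx: "S x = x + Y x" for x by (simp add: Y_def blinfun.bilinear_simps)
  have SS: "S (S x) = D x" for x
    using near_sqrt(2)[OF D] by (metis S_def blinfun_apply_blinfun_compose)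
  have Y: "norm (Y x) \<le> 1/2 * norm x" for x
    using near_sqrt(1)[OF D] norm_blinfun[of Y x] mult_right_mono[of "norm Y" "1/2" "norm x"]
    by (simp add: Y_def S_def)
  define F where "F x y = inner (S x) (S y) - inner x y" for x y
  have F_add: "F (x + x') y = F x y + F x' y" "F x (y + y') = F x y + F x y'" for x x' y y'
    by (simp_all add: F_def blinfun.add_right inner_add_left inner_add_right)
  have F2: "2 * F x y = - (F (Y x) y + F x (Y y) + F (Y x) (Y y))" for x y
  proof -
    have "F (S x) (S y) = - F x y"
      by (simp add: F_def SS blinfun_isometry_inner[OF iso])
    then show ?thesis unfolding Sx F_add by linarith
  qed
  have "\<bar>F x y\<bar> \<le> ((norm S)\<^sup>2 + 1) * (5/8)^n * norm x * norm y" for n x y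
  proof (induction n arbitrary: x y)
    case 0
    have "\<bar>F x y\<bar> \<le> norm (S x) * norm (S y) + norm x * norm y"
      unfolding F_def by (intro order_trans[OF abs_triangle_ineq4] add_mono Cauchy_Schwarz_ineq2)
    also have "norm (S x) * norm (S y) \<le> (norm S * norm x) * (norm S * norm y)"
      by (intro mult_mono norm_blinfun) auto
    finally show ?case by (simp add: power2_eq_square algebra_simps)
  next
    case (Suc n)
    define K where "K = ((norm S)\<^sup>2 + 1) * (5/8)^n"
    have K: "0 \<le> K" by (simp add: K_def)
    note IH = Suc.IH[folded K_def]
    have "\<bar>F (Y x) y\<bar> \<le> K * (1/2 * norm x) * norm y"
      by (rule order_trans[OF IH]) (intro mult_mono Y order_refl; simp add: K)
    moreover have "\<bar>F x (Y y)\<bar> \<le> K * norm x * (1/2 * norm y)"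
      by (rule order_trans[OF IH]) (intro mult_mono Y order_refl; simp add: K)
    moreover have "\<bar>F (Y x) (Y y)\<bar> \<le> K * (1/2 * norm x) * (1/2 * norm y)"
      by (rule order_trans[OF IH]) (intro mult_mono Y order_refl; simp add: K)
    \<comment> \<open>The factor 5/8 is half of 1/2 + 1/2 + 1/4.\<close>
    ultimately have "\<bar>F x y\<bar> \<le> K * (5/8) * norm x * norm y"
      using F2[of x y] by (simp add: algebra_simps)
    then show ?case by (simp add: K_def algebra_simps)
  qed
  moreover have "(\<lambda>n. ((norm S)\<^sup>2 + 1) * (5/8)^n * norm x * norm x) \<longlonglongrightarrow> ((norm S)\<^sup>2 + 1) * 0 * norm x * norm x"
    by (intro tendsto_intros LIMSEQ_power_zero) simp
  ultimately have "\<bar>F x x\<bar> \<le> 0"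
    by (intro LIMSEQ_le_const) auto
  then show ?thesis by (simp add: F_def S_def norm_eq_sqrt_inner)
qed

section \<open>Equivariant lifting\<close>

instance chilbert \<subseteq> banach ..

lemma norm_blinfun_isometry_le:
  fixes A :: "'a::real_normed_vector \<Rightarrow>\<^sub>L 'b::real_normed_vector"
  assumes "\<And>x. norm (A x) = norm x"
  shows "norm A \<le> 1"
  by (rule norm_blinfun_bound) (simp_all add: assms)

lemmas continuous_on_blinfun_compose [continuous_intros] =
  bounded_bilinear.continuous_on[OF bounded_bilinear_blinfun_compose]

text \<open>An abstract setting for the lifting: \<Theta> stands for time reversal,
  \<open>sym k\<close> for the isometries with which operators at momentum \<open>k\<close> have to
  commute, \<open>lattice\<close> for the periods. That time reversal squares to a sign enters as
  centrality of the square of \<Theta>, which covers both signs.\<close>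

locale involutive_conjugation =
  fixes \<Theta> \<Theta>i :: "'a::{real_inner,banach} \<Rightarrow>\<^sub>L 'a"
    and sym :: "'k::real_normed_vector \<Rightarrow> ('a \<Rightarrow>\<^sub>L 'a) set"
    and lattice :: "'k set"
  assumes \<Theta>\<Theta>i [simp]: "\<Theta> (\<Theta>i x) = x" and \<Theta>i\<Theta> [simp]: "\<Theta>i (\<Theta> x) = x"
    and norm_\<Theta>: "norm (\<Theta> x) = norm x"
    and \<Theta>_square_central: "\<And>(A :: 'a \<Rightarrow>\<^sub>L 'a) x. \<Theta> (\<Theta> (A x)) = A (\<Theta> (\<Theta> x))"
    and sym_isometry: "Q \<in> sym k \<Longrightarrow> norm (Q x) = norm x"
    and sym_inverse: "Q \<in> sym k \<Longrightarrow> \<exists>R. Q o\<^sub>L R = id_blinfun \<and> R o\<^sub>L Q = id_blinfun"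
    and lattice_minus: "n \<in> lattice \<Longrightarrow> - n \<in> lattice"
begin

definition flip :: "real \<times> 'k \<Rightarrow> real \<times> 'k" where
  "flip p = (fst p, - snd p)"

definition conj_op :: "('a \<Rightarrow>\<^sub>L 'a) \<Rightarrow> 'a \<Rightarrow>\<^sub>L 'a" where
  "conj_op A = \<Theta> o\<^sub>L A o\<^sub>L \<Theta>i"

text \<open>The class is closed under composition and under roots near the identity, so every
  correction of a lift stays in it. Isometry prevents the constants from growing along the
  steps.\<close>

definition admissible :: "(real \<times> 'k \<Rightarrow> 'a \<Rightarrow>\<^sub>L 'a) \<Rightarrow> bool" where
  "admissible V \<longleftrightarrow> continuous_on UNIV V \<and> (\<forall>p x. norm (V p x) = norm x)
    \<and> (\<forall>t k n. n \<in> lattice \<longrightarrow> V (t, k + n) = V (t, k))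
    \<and> (\<forall>t k Q x. Q \<in> sym k \<longrightarrow> V (t, k) (Q x) = Q (V (t, k) x))"

text \<open>A two-sided inverse is part of the data because a linear isometry of an
  infinite-dimensional space need not be onto.\<close>

definition lifts :: "(real \<times> 'k \<Rightarrow> 'a \<Rightarrow>\<^sub>L 'a) \<Rightarrow> (real \<times> 'k \<Rightarrow> 'a \<Rightarrow>\<^sub>L 'a) \<Rightarrow> bool" where
  "lifts V \<delta> \<longleftrightarrow> admissible \<delta> \<and> (\<exists>\<delta>i. admissible \<delta>i
    \<and> (\<forall>p x. \<delta> p (\<delta>i p x) = x) \<and> (\<forall>p x. \<delta>i p (\<delta> p x) = x))
    \<and> (\<forall>p. V p o\<^sub>L \<delta> p = conj_op (\<delta> (flip p)))"

lemma flip_flip [simp]: "flip (flip p) = p"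
  by (simp add: flip_def)

lemma continuous_on_flip [continuous_intros]: "continuous_on A flip"
  unfolding flip_def[abs_def] by (intro continuous_intros)

lemma admissibleD:
  assumes "admissible V"
  shows "continuous_on UNIV V" "norm (V p x) = norm x" "n \<in> lattice \<Longrightarrow> V (t, k + n) = V (t, k)"
    "Q \<in> sym k \<Longrightarrow> V (t, k) (Q x) = Q (V (t, k) x)"
  using assms unfolding admissible_def by blast+

lemma admissible_compose:
  assumes "admissible V" "admissible W"
  shows "admissible (\<lambda>p. V p o\<^sub>L W p)"
  using assms unfolding admissible_def by (auto intro!: continuous_intros)

lemma norm_\<Theta>i: "norm (\<Theta>i x) = norm x"
  using norm_\<Theta>[of "\<Theta>i x"] by simp

lemma near_sqrt_conj_op:
  assumes "norm (D - id_blinfun) \<le> 1/2"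
  shows "near_sqrt (conj_op D) = conj_op (near_sqrt D)"
  unfolding conj_op_def
  by (rule near_sqrt_conjugate[OF assms])
    (auto intro!: blinfun_eqI norm_blinfun_isometry_le norm_\<Theta> norm_\<Theta>i)

text \<open>Commutation with \<open>Q\<close> means that conjugation by \<open>Q\<close> fixes
  \<open>D\<close>; by uniqueness it fixes the root.\<close>

lemma admissible_near_sqrt:
  assumes D: "admissible D" and near: "\<And>p. norm (D p - id_blinfun) \<le> 1/2"
  shows "admissible (\<lambda>p. near_sqrt (D p))"
proof -
  note aD = admissibleD[OF D]
  have "near_sqrt (D (t, k)) (Q x) = Q (near_sqrt (D (t, k)) x)" if Q: "Q \<in> sym k" for t k Q x
  proof -
    obtain R where R: "Q o\<^sub>L R = id_blinfun" "R o\<^sub>L Q = id_blinfun" using sym_inverse[OF Q] by blast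
    then have QR: "Q (R x) = x" "R (Q x) = x" for x
      by (metis blinfun_apply_blinfun_compose blinfun_apply_id_blinfun)+
    have "norm (R x) = norm x" for x using sym_isometry[OF Q, of "R x"] QR by simp
    then have "near_sqrt (Q o\<^sub>L D (t, k) o\<^sub>L R) = Q o\<^sub>L near_sqrt (D (t, k)) o\<^sub>L R"
      by (intro near_sqrt_conjugate near R norm_blinfun_isometry_le sym_isometry[OF Q])
    also have "Q o\<^sub>L D (t, k) o\<^sub>L R = D (t, k)"
      by (rule blinfun_eqI) (simp add: QR flip: aD(4)[OF Q])
    finally show ?thesis
      by (metis QR(2) blinfun_apply_blinfun_compose)
  qed
  then show ?thesis
    using continuous_on_near_sqrt[OF aD(1) near] near_sqrt_isometry[OF near aD(2)]
    by (auto simp: admissible_def aD(3))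
qed

text \<open>The assumption provides a right inverse only. Taking it at \<open>flip p\<close> and
  conjugating by \<Theta> gives the left inverse, because the square of \<Theta> passes through
  \<open>V\<close>.\<close>

lemma admissible_conj_flip:
  assumes V: "admissible V" and inv: "\<And>p. V p o\<^sub>L conj_op (V (flip p)) = id_blinfun"
  shows "admissible (\<lambda>p. conj_op (V (flip p)))"
    "V p (conj_op (V (flip p)) x) = x" "conj_op (V (flip p)) (V p x) = x"
proof -
  note aV = admissibleD[OF V]
  have ri: "V p (conj_op (V (flip p)) x) = x" for p x
    using inv[of p] by (metis blinfun_apply_blinfun_compose blinfun_apply_id_blinfun)
  have li: "conj_op (V (flip p)) (V p x) = x" for p x
  proof -
    have "x = \<Theta> (V (flip p) (conj_op (V p) (\<Theta>i x)))" using ri[of "flip p" "\<Theta>i x"] by simp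
    also have "\<dots> = \<Theta> (V (flip p) (\<Theta>i (\<Theta> (\<Theta> (V p (\<Theta>i (\<Theta>i x)))))))" by (simp add: conj_op_def)
    also have "\<dots> = conj_op (V (flip p)) (V p x)"
      by (simp add: \<Theta>_square_central conj_op_def)
    finally show ?thesis by simp
  qed
  show "V p (conj_op (V (flip p)) x) = x" "conj_op (V (flip p)) (V p x) = x" by (fact ri li)+
  have "continuous_on UNIV (\<lambda>p. conj_op (V (flip p)))"
    unfolding conj_op_def
    by (intro continuous_intros continuous_on_compose2[OF aV(1)] subset_UNIV)
  \<comment> \<open>Being the inverse of \<open>V\<close>, the conjugate commutes with whatever
    \<open>V\<close> commutes with.\<close>
  moreover have "conj_op (V (flip (t, k))) (Q x) = Q (conj_op (V (flip (t, k))) x)"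
    if Q: "Q \<in> sym k" for t k Q x
    using aV(4)[OF Q] by (metis li ri)
  moreover have "V (flip (t, k + n)) = V (flip (t, k))" if "n \<in> lattice" for t k n
    using aV(3)[OF lattice_minus[OF that], of t "- k"] by (simp add: flip_def)
  ultimately show "admissible (\<lambda>p. conj_op (V (flip p)))"
    unfolding admissible_def by (auto simp: conj_op_def norm_\<Theta> norm_\<Theta>i aV(2))
qed

text \<open>With \<open>D = \<delta>\<inverse> V\<inverse> B \<delta>\<close> one has \<open>\<Theta> D(-k) \<Theta>\<inverse> = D(k)\<inverse>\<close>, hence \<open>\<Theta> S(-k) \<Theta>\<inverse> = S(k)\<inverse>\<close>
  for \<open>S = D\<^sup>1\<^sup>/\<^sup>2\<close>, and \<open>V \<delta> S = B \<delta> S\<inverse> = \<Theta> \<delta>(-k) S(-k) \<Theta>\<inverse>\<close>.\<close>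
lemma lifts_step:
  assumes B: "admissible B" "\<And>p. B p o\<^sub>L conj_op (B (flip p)) = id_blinfun"
    and V: "admissible V" "\<And>p. V p o\<^sub>L conj_op (V (flip p)) = id_blinfun"
    and near: "\<And>p. norm (B p - V p) \<le> 1/2"
    and lift: "lifts B \<delta>"
  shows "\<exists>\<delta>'. lifts V \<delta>'"
proof -
  obtain \<delta>i where \<delta>: "admissible \<delta>" and \<delta>i: "admissible \<delta>i"
    and dd [simp]: "\<And>p x. \<delta> p (\<delta>i p x) = x" "\<And>p x. \<delta>i p (\<delta> p x) = x"
    and lif: "\<And>p. B p o\<^sub>L \<delta> p = conj_op (\<delta> (flip p))"
    using lift unfolding lifts_def by blast
  define W where "W p = conj_op (V (flip p))" for p
  define C where "C p = conj_op (B (flip p))" for p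
  note aW = admissible_conj_flip(1)[OF V, folded W_def]
  note aC = admissible_conj_flip(1)[OF B, folded C_def]
  note [simp] = admissible_conj_flip(2,3)[OF V, folded W_def] admissible_conj_flip(2,3)[OF B, folded C_def]
  have push_\<delta>: "\<Theta> (\<delta> (flip p) x) = B p (\<delta> p (\<Theta> x))" for p x
    using lif[of p] by (metis \<Theta>i\<Theta> blinfun_apply_blinfun_compose conj_op_def)
  have push_\<delta>i: "\<Theta> (\<delta>i (flip p) x) = \<delta>i p (C p (\<Theta> x))" for p x
    using push_\<delta>[of p "\<delta>i (flip p) x"] by simp
  have push_V: "\<Theta> (V (flip p) x) = W p (\<Theta> x)" for p x by (simp add: W_def conj_op_def)
  have push_B: "\<Theta> (B (flip p) x) = C p (\<Theta> x)" for p x by (simp add: C_def conj_op_def)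
  have push_W: "\<Theta> (W (flip p) x) = V p (\<Theta> x)" for p x
    using push_V[of p "W (flip p) x"] by (metis admissible_conj_flip(2,3)[OF V, folded W_def])
  define D where "D p = \<delta>i p o\<^sub>L W p o\<^sub>L B p o\<^sub>L \<delta> p" for p
  define E where "E p = \<delta>i p o\<^sub>L C p o\<^sub>L V p o\<^sub>L \<delta> p" for p
  have DE [simp]: "D p (E p x) = x" "E p (D p x) = x" for p x by (simp_all add: D_def E_def)
  have aD: "admissible D" and aE: "admissible E"
    unfolding D_def[abs_def] E_def[abs_def]
    by (intro admissible_compose \<delta> \<delta>i aW aC B V)+
  have n1: "norm (X p) \<le> 1" if "admissible X" for X p
    by (rule norm_blinfun_isometry_le[OF admissibleD(2)[OF that]])
  have nD: "norm (D p - id_blinfun) \<le> 1/2" for p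
  proof -
    have "D p - id_blinfun = (\<delta>i p o\<^sub>L W p) o\<^sub>L ((B p - V p) o\<^sub>L \<delta> p)"
      by (rule blinfun_eqI) (simp add: D_def blinfun.bilinear_simps)
    also have "norm \<dots> \<le> (1 * 1) * ((1/2) * 1)"
      by (intro norm_compose_le(3) n1 \<delta> \<delta>i aW near)
    finally show ?thesis by simp
  qed
  have nE: "norm (E p - id_blinfun) \<le> 1/2" for p
  proof -
    have "E p - id_blinfun = E p o\<^sub>L (id_blinfun - D p)"
      by (rule blinfun_eqI) (simp add: blinfun.bilinear_simps)
    also have "norm \<dots> \<le> 1 * (1/2)"
      by (intro norm_compose_le(3) n1 aE) (use nD in \<open>simp add: norm_minus_commute\<close>)
    finally show ?thesis by simp
  qed
  define S where "S p = near_sqrt (D p)" for p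
  have aS: "admissible S" unfolding S_def[abs_def] by (rule admissible_near_sqrt[OF aD nD])
  have SS: "S p (S p x) = D p x" for p x
    using near_sqrt(2)[OF nD, of p] by (metis S_def blinfun_apply_blinfun_compose)
  have SE: "S p (E p x) = E p (S p x)" for p x
  proof -
    have "S p (E p x) = E p (D p (S p (E p x)))" by simp
    also have "D p (S p (E p x)) = S p (D p (E p x))" by (simp only: SS[symmetric])
    finally show ?thesis by simp
  qed
  define Si where "Si p = E p o\<^sub>L S p" for p
  have SSi [simp]: "S p (Si p x) = x" "Si p (S p x) = x" for p x
    by (simp_all add: Si_def SE SS)
  have aSi: "admissible Si" unfolding Si_def[abs_def] by (intro admissible_compose aE aS)
  have "near_sqrt (E p) = Si p" for p
  proof (rule near_sqrt_unique[OF nE])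
    show "Si p o\<^sub>L Si p = E p"
      by (rule blinfun_eqI) (simp add: Si_def SE SS)
    have "Si p - id_blinfun = Si p o\<^sub>L (id_blinfun - S p)"
      by (rule blinfun_eqI) (simp add: blinfun.bilinear_simps)
    also have "norm \<dots> \<le> 1 * (1/2)"
      by (intro norm_compose_le(3) n1 aSi)
        (use near_sqrt(1)[OF nD, of p] in \<open>simp add: norm_minus_commute S_def\<close>)
    finally show "norm (Si p - id_blinfun) \<le> 1/2" by simp
  qed
  \<comment> \<open>Conjugation sends the factors of \<open>D\<close> to \<open>\<delta>i C\<close>,
    \<open>V\<close>, \<open>C\<close> and \<open>B \<delta>\<close>; the inner \<open>C B\<close>
    cancels and \<open>E\<close> remains.\<close>
  moreover have "conj_op (D (flip p)) = E p" for p
    by (rule blinfun_eqI) (simp add: conj_op_def D_def E_def push_\<delta> push_\<delta>i push_B push_W)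
  ultimately have "conj_op (S (flip p)) = Si p" for p
    using near_sqrt_conj_op[OF nD, of "flip p"] by (simp add: S_def)
  then have push_S: "\<Theta> (S (flip p) x) = Si p (\<Theta> x)" for p x
    by (metis \<Theta>i\<Theta> blinfun_apply_blinfun_compose conj_op_def)
  have VB: "V p (\<delta> p (D p x)) = B p (\<delta> p x)" for p x by (simp add: D_def)
  have "V p o\<^sub>L (\<delta> p o\<^sub>L S p) = conj_op (\<delta> (flip p) o\<^sub>L S (flip p))" for p
  proof (rule blinfun_eqI)
    fix x
    have "conj_op (\<delta> (flip p) o\<^sub>L S (flip p)) x = B p (\<delta> p (Si p x))"
      by (simp add: conj_op_def push_\<delta> push_S)
    \<comment> \<open>Here \<open>V \<delta> D = B \<delta>\<close> is applied to
      \<open>Si x\<close>, and \<open>D Si = S\<close>.\<close>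
    also have "\<dots> = V p (\<delta> p (S p x))" by (simp flip: VB SS)
    finally show "(V p o\<^sub>L (\<delta> p o\<^sub>L S p)) x = conj_op (\<delta> (flip p) o\<^sub>L S (flip p)) x" by simp
  qed
  then have "lifts V (\<lambda>p. \<delta> p o\<^sub>L S p)"
    unfolding lifts_def
    by (intro conjI exI[of _ "\<lambda>p. Si p o\<^sub>L \<delta>i p"] admissible_compose \<delta> \<delta>i aS aSi) simp_all
  then show ?thesis by blast
qed

text \<open>Clamping the first coordinate at \<open>j / N\<close> turns the path into a chain of \<open>N\<close> small steps
  without any gluing.\<close>
lemma lifts_exists:
  assumes V: "admissible V" "\<And>p. V p o\<^sub>L conj_op (V (flip p)) = id_blinfun"
    and start: "\<And>t k. t \<le> 0 \<Longrightarrow> V (t, k) = id_blinfun"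
    and unif: "\<And>s t k. \<bar>s - t\<bar> \<le> 1 / real N \<Longrightarrow> norm (V (s, k) - V (t, k)) \<le> 1/2" and N: "N > 0"
  shows "\<exists>\<delta>. lifts (\<lambda>p. V (min (fst p) 1, snd p)) \<delta>"
proof -
  define U where "U j p = V (min (fst p) (real j / real N), snd p)" for j p
  have aU: "admissible (U j)" for j
    using admissibleD[OF V(1)] unfolding admissible_def U_def
    by (auto intro!: continuous_intros continuous_on_compose2[OF admissibleD(1)[OF V(1)]])
  have iU: "U j p o\<^sub>L conj_op (U j (flip p)) = id_blinfun" for j p
    using V(2)[of "(min (fst p) (real j / real N), snd p)"] by (simp add: U_def flip_def)
  have "\<exists>\<delta>. lifts (U j) \<delta>" for j
  proof (induction j)
    case 0
    have "U 0 = (\<lambda>p. id_blinfun)" by (auto simp: U_def start)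
    moreover have "lifts (\<lambda>p. id_blinfun) (\<lambda>p. id_blinfun)"
      by (auto simp: lifts_def admissible_def conj_op_def intro!: blinfun_eqI exI[of _ "\<lambda>p. id_blinfun"])
    ultimately show ?case by auto
  next
    case (Suc j)
    then obtain \<delta> where \<delta>: "lifts (U j) \<delta>" by blast
    show ?case
    proof (rule lifts_step[OF aU iU aU iU _ \<delta>])
      fix p :: "real \<times> 'k"
      have "\<bar>min x a - min x (a + c)\<bar> \<le> c" if "0 \<le> c" for x a c :: real
        using that by (auto simp: min_def)
      from this[of "1 / real N" "fst p" "real j / real N"]
      have "\<bar>min (fst p) (real j / real N) - min (fst p) (real (Suc j) / real N)\<bar> \<le> 1 / real N"
        by (simp add: add_divide_distrib add.commute)
      then show "norm (U j p - U (Suc j) p) \<le> 1/2" unfolding U_def by (rule unif)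
    qed
  qed
  from this[of N] show ?thesis using N by (simp add: U_def[abs_def])
qed

end

section \<open>Linear differential equations with skew generator\<close>

lemma skew_ode_norm:
  fixes v :: "real \<Rightarrow> 'a::real_inner" and A :: "real \<Rightarrow> 'a \<Rightarrow>\<^sub>L 'a"
  assumes skew: "\<And>s x. inner x (A s x) = 0"
    and v: "\<And>s. (v has_vector_derivative A s (v s)) (at s)"
  shows "norm (v s) = norm (v 0)"
proof -
  have "((\<lambda>s. inner (v s) (v s)) has_real_derivative 0) (at s)" for s
  proof -
    have "((\<lambda>s. inner (v s) (v s)) has_vector_derivative
        (inner (v s) (A s (v s)) + inner (A s (v s)) (v s))) (at s)"
      by (rule bounded_bilinear.has_vector_derivative[OF bounded_bilinear_inner v v])
    then show ?thesis
      by (simp add: has_real_derivative_iff_has_vector_derivative skew inner_commute[of "blinfun_apply _ _"])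
  qed
  then have "inner (v s) (v s) = inner (v 0) (v 0)" by (rule DERIV_isconst_all[OF allI])
  then show ?thesis by (simp add: norm_eq_sqrt_inner)
qed

lemma skew_ode_unique:
  fixes v w :: "real \<Rightarrow> 'a::real_inner" and A :: "real \<Rightarrow> 'a \<Rightarrow>\<^sub>L 'a"
  assumes skew: "\<And>s x. inner x (A s x) = 0"
    and v: "\<And>s. (v has_vector_derivative A s (v s)) (at s)"
    and w: "\<And>s. (w has_vector_derivative A s (w s)) (at s)"
    and "v 0 = w 0"
  shows "v s = w s"
proof -
  have "((\<lambda>s. v s - w s) has_vector_derivative A s (v s - w s)) (at s)" for s
    unfolding blinfun.diff_right by (intro has_vector_derivative_diff v w)
  from skew_ode_norm[OF skew this, of s] show ?thesis using assms(4) by simp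
qed

text \<open>Skewness removes A (v - w) from the derivative of the squared distance and leaves 2 <v -
  w, (A - B) w>. Both norms are conserved, so this is at most 4 \<epsilon> times the squared norm of
  x, and the mean value inequality takes the place of a Gronwall argument.\<close>

lemma skew_ode_diff_bound:
  fixes v w :: "real \<Rightarrow> 'a::real_inner" and A B :: "real \<Rightarrow> 'a \<Rightarrow>\<^sub>L 'a"
  assumes skewA: "\<And>s x. inner x (A s x) = 0" and skewB: "\<And>s x. inner x (B s x) = 0"
    and v: "\<And>s. (v has_vector_derivative A s (v s)) (at s)" and v0: "v 0 = x"
    and w: "\<And>s. (w has_vector_derivative B s (w s)) (at s)" and w0: "w 0 = x"
    and close: "\<And>s. \<bar>s\<bar> \<le> R \<Longrightarrow> norm (A s - B s) \<le> \<epsilon>" and s: "\<bar>s\<bar> \<le> R"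
  shows "(norm (v s - w s))\<^sup>2 \<le> 4 * \<epsilon> * R * (norm x)\<^sup>2"
proof -
  define g where "g s = inner (v s - w s) (v s - w s)" for s
  define g' where "g' s = 2 * inner (v s - w s) ((A s - B s) (w s))" for s
  have nv: "norm (v s) = norm x" "norm (w s) = norm x" for s
    using skew_ode_norm[OF skewA v] skew_ode_norm[OF skewB w] v0 w0 by auto
  have d: "(g has_real_derivative g' s) (at s)" for s
  proof -
    have 1: "((\<lambda>s. v s - w s) has_vector_derivative (A s (v s) - B s (w s))) (at s)"
      by (intro has_vector_derivative_diff v w)
    have "A s (v s) - B s (w s) = A s (v s - w s) + (A s - B s) (w s)"
      by (simp add: blinfun.bilinear_simps)
    then have "inner (v s - w s) (A s (v s) - B s (w s)) = inner (v s - w s) ((A s - B s) (w s))"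
      by (simp only: inner_add_right skewA add_0)
    with bounded_bilinear.has_vector_derivative[OF bounded_bilinear_inner 1 1] show ?thesis
      unfolding g_def g'_def has_real_derivative_iff_has_vector_derivative
      by (simp add: inner_commute)
  qed
  have \<epsilon>: "0 \<le> \<epsilon>" using close[OF s] norm_ge_zero order_trans by blast
  have b: "\<bar>g' s\<bar> \<le> 4 * \<epsilon> * (norm x)\<^sup>2" if "\<bar>s\<bar> \<le> R" for s
  proof -
    have "norm (v s - w s) \<le> norm x + norm x" using norm_triangle_ineq4[of "v s" "w s"] nv by simp
    moreover have "norm ((A s - B s) (w s)) \<le> \<epsilon> * norm x"
      using norm_blinfun[of "A s - B s" "w s"] mult_right_mono[OF close[OF that], of "norm x"] nv by simp
    ultimately have "\<bar>inner (v s - w s) ((A s - B s) (w s))\<bar> \<le> (norm x + norm x) * (\<epsilon> * norm x)"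
      by (intro order_trans[OF Cauchy_Schwarz_ineq2] mult_mono) auto
    then show ?thesis by (simp add: g'_def abs_mult power2_eq_square algebra_simps)
  qed
  have "norm (g s - g 0) \<le> 4 * \<epsilon> * (norm x)\<^sup>2 * norm (s - 0)"
    by (rule field_differentiable_bound[of "{-R..R}" g g'])
      (use s b in \<open>auto intro: has_field_derivative_at_within d\<close>)
  also have "\<dots> \<le> 4 * \<epsilon> * (norm x)\<^sup>2 * R"
    using s \<epsilon> by (intro mult_left_mono) auto
  finally show ?thesis using v0 w0 by (simp add: g_def dot_square_norm algebra_simps)
qed

lemma has_vector_derivative_reflect:
  assumes "\<And>s. (f has_vector_derivative f' s) (at s)"
  shows "((\<lambda>s. f (- s)) has_vector_derivative - f' (- s)) (at s)"
proof -
  have "(uminus has_vector_derivative - 1) (at s)"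
    by (auto intro!: derivative_eq_intros)
  from vector_diff_chain_at[OF this assms] show ?thesis by (simp add: o_def)
qed

lemma has_vector_derivative_shift:
  assumes "\<And>s. (f has_vector_derivative f' s) (at s)"
  shows "((\<lambda>s. f (s + c)) has_vector_derivative f' (s + c)) (at s)"
proof -
  have "((\<lambda>s. s + c) has_vector_derivative 1) (at s)"
    by (auto intro!: derivative_eq_intros)
  from vector_diff_chain_at[OF this assms] show ?thesis by (simp add: o_def)
qed

section \<open>Parallel transport\<close>

locale time_reversal_family =
  fixes P :: "real \<times> (real^'d) \<Rightarrow> ('h::chilbert \<Rightarrow>\<^sub>L 'h)"
    and P' :: "real \<times> (real^'d) \<Rightarrow> (real \<times> (real^'d)) \<Rightarrow>\<^sub>L ('h \<Rightarrow>\<^sub>L 'h)"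
    and \<theta> :: "'h \<Rightarrow> 'h"
    and m :: nat
    and \<xi> :: "nat \<Rightarrow> real^'d \<Rightarrow> 'h"
    and T :: "real^'d \<Rightarrow> real \<Rightarrow> ('h \<Rightarrow>\<^sub>L 'h)"
  assumes rank: "\<forall>q. rank_proj (P q) m"
    and C1_deriv: "\<forall>q. (P has_derivative blinfun_apply (P' q)) (at q)"
    and C1_cont: "continuous_on UNIV P'"
    and per: "periodic_D P"
    and anti: "antiunitary \<theta>"
    and theta_sq: "(\<forall>x. \<theta> (\<theta> x) = x) \<or> (\<forall>x. \<theta> (\<theta> x) = - x)"
    and trs: "\<forall>q x. \<theta> (blinfun_apply (P q) x) = blinfun_apply (P (- q)) (\<theta> x)"
    and frame0: "bloch_frame (\<lambda>k. P (0, k)) m \<xi>"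
    and frame0_cont: "\<forall>a<m. continuous_on UNIV (\<xi> a)"
    and frame0_per: "\<forall>a<m. periodic_d (\<xi> a)"
    and frame0_trs: "trs_frame \<theta> m \<xi>"
    and T0: "\<forall>k. T k 0 = id_blinfun"
    and T_ode: "\<forall>k s. (T k has_vector_derivative
          (((blinfun_apply (P' (s, k)) (1, 0) o\<^sub>L P (s, k)) - (P (s, k) o\<^sub>L blinfun_apply (P' (s, k)) (1, 0)))
            o\<^sub>L T k s)) (at s)"
begin

lemma theta_add: "\<theta> (x + y) = \<theta> x + \<theta> y"
  and theta_scaleC: "\<theta> (scaleC c x) = scaleC (cnj c) (\<theta> x)"
  and cinner_theta: "cinner (\<theta> x) (\<theta> y) = cinner y x"
  using anti by (auto simp: antiunitary_def)

lemma theta_scaleR: "\<theta> (r *\<^sub>R x) = r *\<^sub>R \<theta> x"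
  using theta_scaleC[of "complex_of_real r"] by (simp add: scaleC_of_real)

lemma theta_minus: "\<theta> (- x) = - \<theta> x"
  using theta_scaleR[of "- 1" x] by simp

lemma theta_diff: "\<theta> (x - y) = \<theta> x - \<theta> y"
  using theta_add[of x "- y"] by (simp add: theta_minus)

lemma inner_theta: "inner (\<theta> x) (\<theta> y) = inner x y"
  using cinner_theta[of x y] by (metis Re_cinner inner_commute)

lemma norm_theta: "norm (\<theta> x) = norm x"
  by (simp add: norm_eq_sqrt_inner inner_theta)

lemma bounded_linear_theta: "bounded_linear \<theta>"
  by (rule bounded_linear_intro[where K=1]) (auto simp: theta_add theta_scaleR norm_theta)

definition sgn_theta :: real where
  "sgn_theta = (if fermionic \<theta> then - 1 else 1)"

lemma theta_theta: "\<theta> (\<theta> x) = sgn_theta *\<^sub>R x"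
  using theta_sq by (auto simp: sgn_theta_def fermionic_def)

lemma sgn_theta_square [simp]: "sgn_theta * sgn_theta = 1"
  by (simp add: sgn_theta_def)

lemma orth_proj_P: "orth_proj (P q)"
  using rank unfolding rank_proj_def by blast

lemmas P_iunit = orth_projD(1)[OF orth_proj_P] and P_idem = orth_projD(2)[OF orth_proj_P]
  and inner_P = orth_projD(4)[OF orth_proj_P]

lemma P_periodic: "s0 \<in> \<int> \<Longrightarrow> int_vec n \<Longrightarrow> P (s + s0, k + n) = P (s, k)"
  using per by (auto simp: periodic_D_def)

lemma int_vec_zero [simp]: "int_vec 0"
  by (simp add: int_vec_def)

lemma int_vec_minus: "int_vec n \<Longrightarrow> int_vec (- n)"
  by (simp add: int_vec_def)

section \<open>The derivative of the projections and the commutator that generates the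
  transport\<close>

definition dP :: "real \<Rightarrow> real^'d \<Rightarrow> 'h \<Rightarrow>\<^sub>L 'h" where
  "dP s k = P' (s, k) (1, 0)"

definition generator :: "real \<Rightarrow> real^'d \<Rightarrow> 'h \<Rightarrow>\<^sub>L 'h" where
  "generator s k = (dP s k o\<^sub>L P (s, k)) - (P (s, k) o\<^sub>L dP s k)"

lemma P_has_vector_derivative: "((\<lambda>s. P (s, k)) has_vector_derivative dP s k) (at s)"
proof -
  have "((\<lambda>s. (s, k)) has_derivative (\<lambda>h. (h, 0))) (at s)"
    by (auto intro!: derivative_eq_intros)
  from diff_chain_at[OF this, of P "P' (s, k)"] C1_deriv
  have "((\<lambda>s. P (s, k)) has_derivative (\<lambda>h. P' (s, k) (h, 0))) (at s)"
    by (simp add: o_def)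
  moreover have "P' (s, k) (h, 0) = h *\<^sub>R dP s k" for h
    unfolding dP_def blinfun.scaleR_right[symmetric] by simp
  ultimately show ?thesis by (simp add: has_vector_derivative_def)
qed

lemma P_apply_has_vector_derivative: "((\<lambda>s. P (s, k) x) has_vector_derivative dP s k x) (at s)"
  using bounded_linear.has_vector_derivative[OF blinfun.bounded_linear_left P_has_vector_derivative] .

text \<open>Both sides are derivatives of one function of \<open>s\<close>. The identities for
  \<open>dP\<close> that follow arise in the same way, by differentiating those for
  \<open>P\<close>.\<close>

lemma dP_iunit: "dP s k (iunit x) = iunit (dP s k x)"
  by (rule vector_derivative_unique_at[OF P_apply_has_vector_derivative])
    (use bounded_linear.has_vector_derivative[OF bounded_linear_iunit P_apply_has_vector_derivative]
      in \<open>simp add: P_iunit\<close>)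

lemma inner_dP: "inner (dP s k x) y = inner x (dP s k y)"
proof (rule vector_derivative_unique_at)
  show "((\<lambda>s. inner (P (s, k) x) y) has_vector_derivative inner (dP s k x) y) (at s)"
    by (rule bounded_linear.has_vector_derivative[OF bounded_linear_inner_left P_apply_has_vector_derivative])
  show "((\<lambda>s. inner (P (s, k) x) y) has_vector_derivative inner x (dP s k y)) (at s)"
    unfolding inner_P
    by (rule bounded_linear.has_vector_derivative[OF bounded_linear_inner_right P_apply_has_vector_derivative])
qed

lemma dP_Leibniz: "dP s k x = P (s, k) (dP s k x) + dP s k (P (s, k) x)"
proof (rule vector_derivative_unique_at)
  show "((\<lambda>s. P (s, k) x) has_vector_derivative dP s k x) (at s)"
    by (rule P_apply_has_vector_derivative)
  show "((\<lambda>s. P (s, k) x) has_vector_derivative P (s, k) (dP s k x) + dP s k (P (s, k) x)) (at s)"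
    using bounded_bilinear.has_vector_derivative[OF bounded_bilinear_blinfun_apply
        P_has_vector_derivative[of k s] P_apply_has_vector_derivative[of k x s]] by (simp add: P_idem)
qed

lemma dP_theta: "\<theta> (dP s k x) = - dP (- s) (- k) (\<theta> x)"
proof (rule vector_derivative_unique_at)
  show "((\<lambda>s. \<theta> (P (s, k) x)) has_vector_derivative \<theta> (dP s k x)) (at s)"
    by (rule bounded_linear.has_vector_derivative[OF bounded_linear_theta P_apply_has_vector_derivative])
  have "((\<lambda>s. P (- s, - k) (\<theta> x)) has_vector_derivative - dP (- s) (- k) (\<theta> x)) (at s)"
    by (rule has_vector_derivative_reflect[OF P_apply_has_vector_derivative])
  then show "((\<lambda>s. \<theta> (P (s, k) x)) has_vector_derivative - dP (- s) (- k) (\<theta> x)) (at s)"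
    using trs by simp
qed

lemma dP_periodic: "s0 \<in> \<int> \<Longrightarrow> int_vec n \<Longrightarrow> dP (s + s0) (k + n) = dP s k"
proof (rule vector_derivative_unique_at)
  assume *: "s0 \<in> \<int>" "int_vec n"
  show "((\<lambda>s. P (s, k)) has_vector_derivative dP s k) (at s)" by (rule P_has_vector_derivative)
  have "((\<lambda>s. P (s + s0, k + n)) has_vector_derivative dP (s + s0) (k + n)) (at s)"
    by (rule has_vector_derivative_shift[OF P_has_vector_derivative])
  then show "((\<lambda>s. P (s, k)) has_vector_derivative dP (s + s0) (k + n)) (at s)"
    using P_periodic[OF *] by simp
qed

lemma generator_skew: "inner x (generator s k x) = 0"
  by (simp add: generator_def blinfun.bilinear_simps inner_diff_right)
    (metis inner_P inner_commute inner_dP)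

lemma generator_iunit: "generator s k (iunit x) = iunit (generator s k x)"
  by (simp add: generator_def blinfun.bilinear_simps dP_iunit P_iunit iunit_diff)

lemma generator_periodic: "s0 \<in> \<int> \<Longrightarrow> int_vec n \<Longrightarrow> generator (s + s0) (k + n) = generator s k"
  by (simp add: generator_def dP_periodic P_periodic)

lemma generator_theta: "\<theta> (generator s k x) = - generator (- s) (- k) (\<theta> x)"
  using trs by (simp add: theta_diff generator_def blinfun.bilinear_simps dP_theta)

text \<open>This is dP = [generator, P], the reason for taking [dP, P] as generator. It rests on P
  dP P = 0, the derivative of P P = P compressed to the range.\<close>

lemma generator_intertwines: "dP s k x + P (s, k) (generator s k x) = generator s k (P (s, k) x)"
proof -
  have "P (s, k) (dP s k (P (s, k) x)) = 0"
    using dP_Leibniz[of s k "P (s, k) x"] by (simp add: P_idem)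
  moreover have "dP s k x - P (s, k) (dP s k x) = dP s k (P (s, k) x)"
    by (metis dP_Leibniz add_diff_cancel_left')
  ultimately show ?thesis by (simp add: generator_def blinfun.bilinear_simps P_idem)
qed

lemma continuous_on_generator: "continuous_on UNIV (\<lambda>(s, k). generator s k)"
proof -
  have "continuous_on UNIV P"
    using C1_deriv by (auto intro!: continuous_at_imp_continuous_on has_derivative_continuous)
  moreover have "continuous_on UNIV (\<lambda>q. P' q (1, 0))"
    by (intro continuous_intros C1_cont)
  ultimately show ?thesis
    unfolding generator_def dP_def split_beta prod.collapse
    by (intro continuous_on_diff bounded_bilinear.continuous_on[OF bounded_bilinear_blinfun_compose])
qed

section \<open>Symmetries and continuity of the transport\<close>

lemma T_zero [simp]: "T k 0 x = x"
  using T0 by simp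

lemma T_has_vector_derivative: "((\<lambda>s. T k s x) has_vector_derivative generator s k (T k s x)) (at s)"
  using bounded_linear.has_vector_derivative[OF blinfun.bounded_linear_left T_ode[rule_format]]
  by (simp add: generator_def dP_def)

text \<open>Identities for \<open>T\<close> are proved by checking that both sides solve the same
  initial value problem.\<close>

lemma T_unique:
  assumes "\<And>s. (v has_vector_derivative generator s k (v s)) (at s)" and "v 0 = x"
  shows "v s = T k s x"
  by (rule skew_ode_unique[OF generator_skew assms(1) T_has_vector_derivative]) (simp add: assms(2))

lemma norm_T: "norm (T k s x) = norm x"
  using skew_ode_norm[OF generator_skew T_has_vector_derivative] by simp

lemma inner_T: "inner (T k s x) (T k s y) = inner x y"
  by (rule blinfun_isometry_inner[OF norm_T])

lemma T_iunit: "T k s (iunit x) = iunit (T k s x)"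
  by (rule T_unique[symmetric])
    (use bounded_linear.has_vector_derivative[OF bounded_linear_iunit T_has_vector_derivative]
      in \<open>simp_all add: generator_iunit\<close>)

lemma cinner_T: "cinner (T k s x) (T k s y) = cinner x y"
  by (simp add: cinner_def inner_T flip: T_iunit)

lemma T_intertwines: "P (s, k) (T k s x) = T k s (P (0, k) x)"
proof (rule T_unique)
  fix s
  have "((\<lambda>s. P (s, k) (T k s x)) has_vector_derivative
      P (s, k) (generator s k (T k s x)) + dP s k (T k s x)) (at s)"
    by (rule bounded_bilinear.has_vector_derivative[OF bounded_bilinear_blinfun_apply
          P_has_vector_derivative T_has_vector_derivative])
  then show "((\<lambda>s. P (s, k) (T k s x)) has_vector_derivative generator s k (P (s, k) (T k s x))) (at s)"
    by (simp add: add.commute flip: generator_intertwines)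
qed simp

text \<open>The shifted solution solves the same equation because the generator is periodic. The
  instance with \<open>s = - (1/2)\<close> and \<open>s0 = 1\<close> governs the matching at half a
  period.\<close>

lemma T_shift: "s0 \<in> \<int> \<Longrightarrow> T k (s + s0) x = T k s (T k s0 x)"
proof (rule T_unique)
  fix s assume s0: "s0 \<in> \<int>"
  have "((\<lambda>s. T k (s + s0) x) has_vector_derivative generator (s + s0) k (T k (s + s0) x)) (at s)"
    by (rule has_vector_derivative_shift[OF T_has_vector_derivative])
  then show "((\<lambda>s. T k (s + s0) x) has_vector_derivative generator s k (T k (s + s0) x)) (at s)"
    using generator_periodic[OF s0, of 0 s k] by simp
qed simp

lemma T_periodic: "int_vec n \<Longrightarrow> T (k + n) s x = T k s x"
proof (rule T_unique)
  fix s assume "int_vec n"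
  then show "((\<lambda>s. T (k + n) s x) has_vector_derivative generator s k (T (k + n) s x)) (at s)"
    using T_has_vector_derivative[of "k + n" x s] generator_periodic[of 0 n s k] by simp
qed simp

lemma T_theta: "\<theta> (T k s x) = T (- k) (- s) (\<theta> x)"
proof -
  \<comment> \<open>In the reflected variable two signs cancel, one from the chain rule and one from
    \<open>generator_theta\<close>.\<close>
  have "\<theta> (T k (- s) x) = T (- k) s (\<theta> x)" for s
  proof (rule T_unique)
    fix s
    have "((\<lambda>s. T k (- s) x) has_vector_derivative - generator (- s) k (T k (- s) x)) (at s)"
      by (rule has_vector_derivative_reflect[OF T_has_vector_derivative])
    from bounded_linear.has_vector_derivative[OF bounded_linear_theta this]
    show "((\<lambda>s. \<theta> (T k (- s) x)) has_vector_derivative generator s (- k) (\<theta> (T k (- s) x))) (at s)"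
      using generator_theta[of "- s" k] theta_scaleR[of "- 1"] by simp
  qed simp
  from this[of "- s"] show ?thesis by simp
qed

text \<open>Variation in \<open>k\<close> is controlled by uniform closeness of the generators on a
  compact set, variation in \<open>s\<close> at the fixed momentum \<open>k0\<close> by
  differentiability.\<close>

lemma continuous_on_T: "continuous_on UNIV (\<lambda>(s, k). T k s)"
  unfolding continuous_on_iff
proof (intro ballI allI impI)
  fix p0 :: "real \<times> (real^'d)" and e :: real assume e: "e > 0"
  obtain s0 k0 where p0: "p0 = (s0, k0)" by force
  define R where "R = \<bar>s0\<bar> + 1"
  have R: "R > 0" by (simp add: R_def)
  \<comment> \<open>Chosen so that the bound in \<open>skew_ode_diff_bound\<close> stays below the
    square of \<open>e / 2 * norm x\<close>.\<close>
  define \<epsilon> where "\<epsilon> = (e / 2)\<^sup>2 / (8 * R)"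
  have \<epsilon>: "\<epsilon> > 0" using e R by (simp add: \<epsilon>_def)
  have "uniformly_continuous_on (cball 0 R \<times> cball k0 1) (\<lambda>(s, k). generator s k)"
    by (intro compact_uniformly_continuous continuous_on_subset[OF continuous_on_generator]
        compact_Times) auto
  then obtain d1 where d1: "d1 > 0" and gen: "\<And>s k s' k'. \<bar>s\<bar> \<le> R \<Longrightarrow> \<bar>s'\<bar> \<le> R \<Longrightarrow> dist k0 k \<le> 1 \<Longrightarrow>
      dist k0 k' \<le> 1 \<Longrightarrow> dist (s', k') (s, k) < d1 \<Longrightarrow> dist (generator s' k') (generator s k) < \<epsilon>"
    unfolding uniformly_continuous_on_def using \<epsilon> by (fastforce simp: dist_norm)
  have "continuous (at s0) (T k0)"
    using T_ode by (auto intro: has_vector_derivative_continuous)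
  then obtain d2 where d2: "d2 > 0" and Ts: "\<And>s. dist s s0 < d2 \<Longrightarrow> dist (T k0 s) (T k0 s0) < e / 2"
    unfolding continuous_at_eps_delta using e by (metis half_gt_zero)
  show "\<exists>d>0. \<forall>p\<in>UNIV. dist p p0 < d \<longrightarrow>
      dist (case p of (s, k) \<Rightarrow> T k s) (case p0 of (s, k) \<Rightarrow> T k s) < e"
  proof (intro exI[of _ "min 1 (min d1 d2)"] conjI ballI impI)
    fix p assume p: "dist p p0 < min 1 (min d1 d2)"
    obtain s k where sk: "p = (s, k)" by force
    have ds: "dist s s0 < 1" "dist s s0 < d2" and dk: "dist k k0 < 1" "dist k k0 < d1"
      using p dist_fst_le[of p p0] dist_snd_le[of p p0] by (auto simp: sk p0)
    have sR: "\<bar>s\<bar> \<le> R" using ds by (auto simp: R_def dist_real_def)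
    have "norm (generator r k - generator r k0) \<le> \<epsilon>" if "\<bar>r\<bar> \<le> R" for r
      using gen[of r r k0 k] that dk by (simp add: dist_norm dist_Pair_Pair norm_minus_commute less_imp_le)
    then have "(norm (T k s x - T k0 s x))\<^sup>2 \<le> 4 * \<epsilon> * R * (norm x)\<^sup>2" for x
      using skew_ode_diff_bound[OF generator_skew generator_skew T_has_vector_derivative T_zero
          T_has_vector_derivative T_zero _ sR] by blast
    also have "4 * \<epsilon> * R * (norm x)\<^sup>2 \<le> (e / 2 * norm x)\<^sup>2" for x :: 'h
    proof -
      have "4 * \<epsilon> * R = (e/2)\<^sup>2 / 2" using R by (simp add: \<epsilon>_def)
      also have "\<dots> \<le> (e/2)\<^sup>2" by simp
      finally show ?thesis unfolding power_mult_distrib by (rule mult_right_mono) simp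
    qed
    finally have "norm ((T k s - T k0 s) x) \<le> e / 2 * norm x" for x
      using power2_le_imp_le e by (simp add: blinfun.diff_left)
    then have "norm (T k s - T k0 s) \<le> e / 2"
      using e by (intro norm_blinfun_bound) auto
    then show "dist (case p of (s, k) \<Rightarrow> T k s) (case p0 of (s, k) \<Rightarrow> T k s) < e"
      using Ts[OF ds(2)] norm_triangle_ineq[of "T k s - T k0 s" "T k0 s - T k0 s0"] by (simp add: sk p0 dist_norm)
  qed (use d1 d2 in auto)
qed

end

section \<open>Matching matrices\<close>

lemma sum_delta_mult:
  fixes f :: "nat \<Rightarrow> 'a::semiring_1"
  assumes "a < m"
  shows "(\<Sum>c<m. (if a = c then 1 else 0) * f c) = f a" "(\<Sum>c<m. f c * (if c = a then 1 else 0)) = f a"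
  using assms by (simp_all add: if_distrib[of "\<lambda>x. x * _"] if_distrib[of "\<lambda>x. _ * x"] cong: if_cong)

lemmas continuous_on_cinner [continuous_intros] = cinner.continuous_on
lemmas continuous_on_scaleC [continuous_intros] = scaleC.continuous_on

context time_reversal_family
begin

section \<open>The algebra of the matrix \<epsilon>\<close>

definition eps :: "nat \<Rightarrow> nat \<Rightarrow> complex" where
  "eps = eps_mat (fermionic \<theta>) m"

lemma cnj_eps [simp]: "cnj (eps a b) = eps a b"
  by (simp add: eps_def eps_mat_def)

lemma theta_sum: "\<theta> (\<Sum>a\<in>A. f a) = (\<Sum>a\<in>A. \<theta> (f a))"
  using linear_sum[OF bounded_linear.linear[OF bounded_linear_theta]] by simp

lemma onb_frame0: "onb_of_range (P (0, k)) m (\<lambda>a. \<xi> a k)"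
  using frame0 by (simp add: bloch_frame_def)

lemmas frame0_orthonormal = onb_of_rangeD(1)[OF orth_proj_P onb_frame0]
  and P_frame0 [simp] = onb_of_rangeD(2)[OF orth_proj_P onb_frame0]
  and P0_expand = onb_of_rangeD(3)[OF orth_proj_P onb_frame0]

lemma trs_frame_apply:
  "trs_frame \<theta> m \<eta> \<Longrightarrow> b < m \<Longrightarrow> \<eta> b (- q) = (\<Sum>a<m. scaleC (eps a b) (\<theta> (\<eta> a q)))"
  by (simp add: trs_frame_def eps_def)

text \<open>In the fermionic case the block formula has the expected algebra only for suitable
  \<open>m\<close>. The relations are therefore read off from the given frame at momentum 0, which
  time reversal fixes: both sides of the symmetry condition are orthonormal there.\<close>

lemma eps_orthogonal:
  assumes "a < m" "b < m"
  shows "(\<Sum>c<m. eps c a * eps c b) = (if a = b then 1 else 0)"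
proof -
  have "(if a = b then 1 else 0) = cinner (\<xi> a (- 0)) (\<xi> b (- 0))"
    using orthonormalD[OF frame0_orthonormal assms] by simp
  also have "\<dots> = (\<Sum>c<m. \<Sum>d<m. eps c a * eps d b * cinner (\<xi> d 0) (\<xi> c 0))"
    unfolding trs_frame_apply[OF frame0_trs assms(1)] trs_frame_apply[OF frame0_trs assms(2)] cinner.sum_left
    by (intro sum.cong refl) (simp add: cinner.sum_right cinner_theta sum_distrib_left mult_ac)
  also have "\<dots> = (\<Sum>c<m. \<Sum>d<m. eps c a * (eps d b * (if d = c then 1 else 0)))"
    by (intro sum.cong refl) (simp add: orthonormalD[OF frame0_orthonormal])
  also have "\<dots> = (\<Sum>c<m. eps c a * eps c b)"
    by (intro sum.cong refl) (simp add: sum_delta_mult flip: sum_distrib_left)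
  finally show ?thesis by simp
qed

lemma theta_frame0:
  assumes "b < m"
  shows "\<theta> (\<xi> b (- k)) = (\<Sum>a<m. scaleC (sgn_theta * eps a b) (\<xi> a k))"
  by (simp add: trs_frame_apply[OF frame0_trs assms] theta_sum theta_scaleC theta_theta
      flip: scaleC_of_real) (simp add: mult.commute)

text \<open>Applying the symmetry condition twice at momentum 0 returns the frame, which forces the
  square of the matrix to be the sign of the square of \<theta>.\<close>

lemma eps_square:
  assumes "a < m" "b < m"
  shows "(\<Sum>c<m. eps a c * eps c b) = (if a = b then complex_of_real sgn_theta else 0)"
proof -
  have "\<xi> b 0 = (\<Sum>c<m. scaleC (eps c b) (\<theta> (\<xi> c (- 0))))"
    using trs_frame_apply[OF frame0_trs assms(2), of "- 0"] by simp
  also have "\<dots> = (\<Sum>c<m. \<Sum>a<m. scaleC (sgn_theta * (eps a c * eps c b)) (\<xi> a 0))"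
    by (intro sum.cong refl) (simp only: theta_frame0 scaleC.sum_right lessThan_iff scaleC_scaleC mult_ac)
  also have "\<dots> = (\<Sum>a<m. scaleC (sgn_theta * (\<Sum>c<m. eps a c * eps c b)) (\<xi> a 0))"
    by (subst sum.swap) (simp add: scaleC.sum_left sum_distrib_left)
  finally have "cinner (\<xi> a 0) (\<xi> b 0) = sgn_theta * (\<Sum>c<m. eps a c * eps c b)"
    using cinner_orthonormal_sum[OF frame0_orthonormal assms(1)] by simp
  then have "complex_of_real sgn_theta * (if a = b then 1 else 0) =
      complex_of_real (sgn_theta * sgn_theta) * (\<Sum>c<m. eps a c * eps c b)"
    using orthonormalD[OF frame0_orthonormal assms, of 0] by (simp only: of_real_mult mult.assoc)
  then show ?thesis by (auto split: if_splits)
qed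

text \<open>Orthogonality and \<open>eps_square\<close> combine to \<epsilon> = \<epsilon>^t
  \<epsilon> \<epsilon> = \<open>sgn_theta\<close> \<epsilon>^t.\<close>

lemma eps_transpose:
  assumes "a < m" "b < m"
  shows "eps a b = sgn_theta * eps b a"
proof -
  have "eps a b = (\<Sum>d<m. (\<Sum>c<m. eps c a * eps c d) * eps d b)"
    using assms sum_delta_mult(1)[OF assms(1), of "\<lambda>d. eps d b"] by (simp add: eps_orthogonal)
  also have "\<dots> = (\<Sum>c<m. eps c a * (\<Sum>d<m. eps c d * eps d b))"
    unfolding sum_distrib_right sum_distrib_left by (subst sum.swap) (simp only: mult.assoc)
  also have "\<dots> = (\<Sum>c<m. (eps c a * complex_of_real sgn_theta) * (if c = b then 1 else 0))"
    using assms by (intro sum.cong refl) (auto simp: eps_square)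
  also have "\<dots> = eps b a * complex_of_real sgn_theta" by (rule sum_delta_mult(2)[OF assms(2)])
  finally show ?thesis by (simp add: mult.commute)
qed

lemma sgn_theta_mult_cancel [simp]: "complex_of_real sgn_theta * (complex_of_real sgn_theta * x) = x"
  by (simp flip: mult.assoc of_real_mult)

lemma eps_orthogonal':
  assumes "a < m" "b < m"
  shows "(\<Sum>c<m. eps a c * eps b c) = (if a = b then 1 else 0)"
proof -
  have "(\<Sum>c<m. eps a c * eps b c) = (\<Sum>c<m. eps c a * eps c b)"
    using assms by (intro sum.cong refl) (simp add: eps_transpose[of a] eps_transpose[of b])
  then show ?thesis by (simp add: eps_orthogonal assms)
qed

lemma theta_frame0':
  assumes "b < m"
  shows "\<theta> (\<xi> b (- k)) = (\<Sum>a<m. scaleC (eps b a) (\<xi> a k))"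
  unfolding theta_frame0[OF assms] using assms
  by (intro sum.cong refl) (simp add: eps_transpose[of b])

text \<open>The right side is A' = \<epsilon>^t A^t \<epsilon>, the matching relation solved for A'.
  Expansions in a symmetric frame produce this form directly.\<close>

lemma matching_conj_iff:
  "(\<forall>a<m. \<forall>b<m. (\<Sum>c<m. eps a c * A c b) = (\<Sum>c<m. A' c a * eps c b)) \<longleftrightarrow>
   (\<forall>a<m. \<forall>b<m. A' a b = (\<Sum>c<m. eps c a * (\<Sum>d<m. eps d b * A d c)))" (is "?L \<longleftrightarrow> ?R")
proof (intro iffI allI impI)
  fix a b assume L: ?L and ab: "a < m" "b < m"
  have "(\<Sum>c<m. eps c a * (\<Sum>d<m. eps d b * A d c)) = (\<Sum>c<m. eps a c * (\<Sum>d<m. eps b d * A d c))"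
  proof (intro sum.cong refl)
    fix c assume "c \<in> {..<m}"
    moreover have "(\<Sum>d<m. eps b d * A d c) = sgn_theta * (\<Sum>d<m. eps d b * A d c)"
      unfolding sum_distrib_left using ab
      by (intro sum.cong refl) (simp add: eps_transpose[of b] mult.assoc)
    ultimately show "eps c a * (\<Sum>d<m. eps d b * A d c) = eps a c * (\<Sum>d<m. eps b d * A d c)"
      using ab by (simp add: eps_transpose[of a] mult_ac)
  qed
  also have "\<dots> = (\<Sum>c<m. eps a c * (\<Sum>d<m. A' d b * eps d c))"
    using L ab by simp
  also have "\<dots> = (\<Sum>d<m. A' d b * (\<Sum>c<m. eps a c * eps d c))"
    by (simp add: sum_distrib_left mult_ac) (rule sum.swap)
  also have "\<dots> = (\<Sum>d<m. A' d b * (if d = a then 1 else 0))"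
    using ab by (intro sum.cong refl) (auto simp: eps_orthogonal')
  also have "\<dots> = A' a b" by (rule sum_delta_mult(2)[OF ab(1)])
  finally show "A' a b = (\<Sum>c<m. eps c a * (\<Sum>d<m. eps d b * A d c))" by simp
next
  fix a b assume R: ?R and ab: "a < m" "b < m"
  have "(\<Sum>c<m. A' c a * eps c b) = (\<Sum>c<m. (\<Sum>e<m. eps e c * (\<Sum>d<m. eps d a * A d e)) * eps c b)"
    using R ab by simp
  also have "\<dots> = (\<Sum>e<m. (\<Sum>d<m. eps d a * A d e) * (\<Sum>c<m. eps e c * eps c b))"
    by (subst sum_distrib_right, subst sum_distrib_left, subst sum.swap) (simp only: mult_ac)
  also have "\<dots> = (\<Sum>e<m. ((\<Sum>d<m. eps d a * A d e) * complex_of_real sgn_theta) * (if e = b then 1 else 0))"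
    using ab by (intro sum.cong refl) (auto simp: eps_square)
  also have "\<dots> = (\<Sum>d<m. eps d a * A d b) * complex_of_real sgn_theta"
    by (rule sum_delta_mult(2)[OF ab(2)])
  also have "\<dots> = (\<Sum>d<m. eps a d * A d b)"
    unfolding sum_distrib_right using ab
    by (intro sum.cong refl) (simp add: eps_transpose[of a] mult_ac)
  finally show "(\<Sum>c<m. eps a c * A c b) = (\<Sum>c<m. A' c a * eps c b)" by simp
qed

section \<open>The transported frame and its transition matrix\<close>

lemma T_scaleC: "T k s (scaleC c x) = scaleC c (T k s x)"
  by (simp add: scaleC_def blinfun.bilinear_simps T_iunit)

lemma T_inverse [simp]: "T k 1 (T k (- 1) x) = x"
  using T_shift[of "- 1" k 1 x] by simp

lemma P_T_frame0: "a < m \<Longrightarrow> P (s, k) (T k s (\<xi> a k)) = T k s (\<xi> a k)"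
  by (simp add: T_intertwines)

lemma T_frame0_orthonormal: "orthonormal m (\<lambda>a. T k s (\<xi> a k))"
  using frame0_orthonormal by (simp add: orthonormal_def cinner_T)

text \<open>Transport keeps the frame orthonormal and inside the range; constancy of the rank makes
  it a basis.\<close>

lemma onb_T_frame0: "onb_of_range (P (s, k)) m (\<lambda>a. T k s (\<xi> a k))"
proof -
  obtain f where "onb_of_range (P (s, k)) m f" using rank unfolding rank_proj_def by blast
  then show ?thesis
    by (rule onb_of_rangeI[OF orth_proj_P]) (simp_all add: T_frame0_orthonormal P_T_frame0)
qed

lemma P_shift: "s0 \<in> \<int> \<Longrightarrow> P (s + s0, k) = P (s, k)"
  using P_periodic[of s0 0 s k] by simp

lemma T_theta_minus: "T (- k) s (\<theta> x) = \<theta> (T k (- s) x)"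
  by (simp add: T_theta)

lemma frame0_periodic: "a < m \<Longrightarrow> int_vec n \<Longrightarrow> \<xi> a (k + n) = \<xi> a k"
  using frame0_per by (auto simp: periodic_d_def)

lemma continuous_on_T_compose [continuous_intros]:
  assumes "continuous_on A f" "continuous_on A g"
  shows "continuous_on A (\<lambda>x. T (g x) (f x))"
  using continuous_on_compose2[OF continuous_on_T continuous_on_Pair[OF assms]] by auto

lemma continuous_on_frame0 [continuous_intros]:
  assumes "a < m" "continuous_on A g"
  shows "continuous_on A (\<lambda>x. \<xi> a (g x))"
  using continuous_on_compose2[OF frame0_cont[rule_format, OF assms(1)] assms(2)] by auto

text \<open>The holonomy of the transport once around the circle of k_1, written in the reference
  frame: the matrix \<alpha> of the theorem.\<close>

definition transition :: "real^'d \<Rightarrow> nat \<Rightarrow> nat \<Rightarrow> complex" where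
  "transition k a b = cinner (\<xi> a k) (T k 1 (\<xi> b k))"

lemma transition_matching: "matching_family eps m transition"
  unfolding matching_family_def
proof (intro conjI allI impI)
  fix a b assume ab: "a < m" "b < m"
  show "continuous_on UNIV (\<lambda>k. transition k a b)"
    unfolding transition_def using ab by (intro continuous_intros) auto
  show "periodic_d (\<lambda>k. transition k a b)"
    unfolding periodic_d_def transition_def using ab by (simp add: frame0_periodic T_periodic)
next
  fix k
  show "unitary_mat m (transition k)"
    unfolding unitary_mat_def transition_def
  proof (intro allI impI)
    fix a b assume ab: "a < m" "b < m"
    \<comment> \<open>Periodicity brings the transported vector back to the range at 0, so Parseval
      applies in the reference frame.\<close>
    have "P (0, k) (T k 1 (\<xi> b k)) = T k 1 (\<xi> b k)"
      using P_T_frame0[OF ab(2), of 1 k] P_shift[of 1 0 k] by simp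
    from onb_parseval[OF orth_proj_P onb_frame0 this, of "T k 1 (\<xi> a k)"]
    show "(\<Sum>c<m. cnj (cinner (\<xi> c k) (T k 1 (\<xi> a k))) * cinner (\<xi> c k) (T k 1 (\<xi> b k)))
      = (if a = b then 1 else 0)"
      using orthonormalD[OF frame0_orthonormal ab] by (simp add: cnj_cinner cinner_T)
  qed
next
  fix k and a b :: nat
  have "\<forall>a<m. \<forall>b<m. transition (- k) a b =
    (\<Sum>c<m. eps c a * (\<Sum>d<m. eps d b * transition k d c))"
  proof (intro allI impI)
    fix a b assume ab: "a < m" "b < m"
    \<comment> \<open>Time reversal turns transport over 1 into transport over -1, antiunitarity
      swaps the arguments, and unitarity moves the transport to the other side.\<close>
    have *: "cinner (\<theta> x) (T (- k) 1 (\<theta> y)) = cinner y (T k 1 x)" for x y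
      by (metis T_inverse T_theta_minus cinner_T cinner_theta)
    show "transition (- k) a b = (\<Sum>c<m. eps c a * (\<Sum>d<m. eps d b * transition k d c))"
      unfolding transition_def trs_frame_apply[OF frame0_trs ab(1)] trs_frame_apply[OF frame0_trs ab(2)]
        cinner.sum_left
      by (intro sum.cong refl) (simp add: cinner.sum_right blinfun.sum_right T_scaleC * sum_distrib_left mult_ac)
  qed
  moreover assume "a < m" "b < m"
  ultimately show "(\<Sum>c<m. eps a c * transition k c b) = (\<Sum>c<m. transition (- k) c a * eps c b)"
    using matching_conj_iff[of "transition k" "transition (- k)"] by blast
qed

end

section \<open>From a frame to a homotopy\<close>

lemma sum_rotate:
  "(\<Sum>a\<in>A. \<Sum>b\<in>B. \<Sum>c\<in>C. f a b c) = (\<Sum>b\<in>B. \<Sum>c\<in>C. \<Sum>a\<in>A. f a b c)"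
proof -
  have "(\<Sum>a\<in>A. \<Sum>b\<in>B. \<Sum>c\<in>C. f a b c) = (\<Sum>b\<in>B. \<Sum>a\<in>A. \<Sum>c\<in>C. f a b c)" by (rule sum.swap)
  also have "\<dots> = (\<Sum>b\<in>B. \<Sum>c\<in>C. \<Sum>a\<in>A. f a b c)" by (intro sum.cong refl) (rule sum.swap)
  finally show ?thesis .
qed

context time_reversal_family
begin

text \<open>With A(u) the matrix of overlaps of \<Xi>(u, k) with the transported frame, this is
  A(-u)^* A(u). Time reversal relates A(u) to A(-u), which is why the two are paired in one
  product.\<close>

definition frame_homotopy :: "(nat \<Rightarrow> real \<times> (real^'d) \<Rightarrow> 'h) \<Rightarrow> real \<Rightarrow> real^'d \<Rightarrow> nat \<Rightarrow> nat \<Rightarrow> complex" where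
  "frame_homotopy \<Xi> u k a b =
    (\<Sum>c<m. cinner (T k (- u) (\<xi> a k)) (\<Xi> c (- u, k)) * cinner (\<Xi> c (u, k)) (T k u (\<xi> b k)))"

context
  fixes \<Xi> :: "nat \<Rightarrow> real \<times> (real^'d) \<Rightarrow> 'h"
  assumes frame: "bloch_frame P m \<Xi>" and cont: "frame_continuous m \<Xi>"
    and periodic: "\<forall>a<m. periodic_D (\<Xi> a)" and symmetric: "trs_frame \<theta> m \<Xi>"
begin

lemma onb_frame: "onb_of_range (P q) m (\<lambda>a. \<Xi> a q)"
  using frame unfolding bloch_frame_def by blast

lemmas frame_orthonormal = onb_of_rangeD(1)[OF orth_proj_P onb_frame]
  and P_frame = onb_of_rangeD(2)[OF orth_proj_P onb_frame]

lemma frame_periodic: "a < m \<Longrightarrow> s0 \<in> \<int> \<Longrightarrow> int_vec n \<Longrightarrow> \<Xi> a (s + s0, k + n) = \<Xi> a (s, k)"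
  using periodic by (auto simp: periodic_D_def)

lemma continuous_on_frame_compose:
  assumes "a < m" "continuous_on A f"
  shows "continuous_on A (\<lambda>x. \<Xi> a (f x))"
  using continuous_on_compose2[of UNIV "\<Xi> a", OF _ assms(2)] cont assms(1)
  by (auto simp: frame_continuous_def)

lemma continuous_on_frame_homotopy:
  assumes "a < m" "b < m" "continuous_on A f" "continuous_on A g"
  shows "continuous_on A (\<lambda>x. frame_homotopy \<Xi> (f x) (g x) a b)"
  unfolding frame_homotopy_def
  by (intro continuous_on_sum continuous_intros continuous_on_frame_compose assms) auto

lemma unitary_frame_homotopy: "unitary_mat m (frame_homotopy \<Xi> u k)"
  unfolding unitary_mat_def
proof (intro allI impI)
  fix a b assume ab: "a < m" "b < m"
  \<comment> \<open>Coefficients with respect to \<Xi>(u, k) are transplanted to \<Xi>(-u, k); this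
    isometry between the ranges reduces the claim to two Parseval identities.\<close>
  define y where "y b = (\<Sum>c<m. scaleC (cinner (\<Xi> c (u, k)) (T k u (\<xi> b k))) (\<Xi> c (- u, k)))" for b
  have hom: "frame_homotopy \<Xi> u k c b = cinner (T k (- u) (\<xi> c k)) (y b)" for b c
    by (simp add: frame_homotopy_def y_def cinner.sum_right mult.commute)
  have Py: "P (- u, k) (y b) = y b" for b
    by (simp add: y_def blinfun.sum_right scaleC_def blinfun.add_right blinfun.scaleR_right P_iunit P_frame)
  have "(\<Sum>c<m. cnj (frame_homotopy \<Xi> u k c a) * frame_homotopy \<Xi> u k c b) = cinner (y a) (y b)"
    unfolding hom cnj_cinner by (rule onb_parseval[OF orth_proj_P onb_T_frame0 Py, symmetric])
  also have "\<dots> = (\<Sum>c<m. cinner (T k u (\<xi> a k)) (\<Xi> c (u, k)) * cinner (\<Xi> c (u, k)) (T k u (\<xi> b k)))"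
    by (subst (1) y_def, unfold cinner.sum_left, intro sum.cong refl)
      (simp add: y_def cinner_orthonormal_sum[OF frame_orthonormal] cnj_cinner)
  also have "\<dots> = cinner (T k u (\<xi> a k)) (T k u (\<xi> b k))"
    by (rule onb_parseval[OF orth_proj_P onb_frame P_T_frame0[OF ab(2)], symmetric])
  also have "\<dots> = (if a = b then 1 else 0)"
    using orthonormalD[OF T_frame0_orthonormal ab] .
  finally show "(\<Sum>c<m. cnj (frame_homotopy \<Xi> u k c a) * frame_homotopy \<Xi> u k c b) = (if a = b then 1 else 0)" .
qed

text \<open>Time reversal exchanges the two overlap factors. The \<epsilon> attached to the summed
  index of \<Xi> cancel by orthogonality; those of the reference frame remain.\<close>

lemma frame_homotopy_symmetric:
  assumes ab: "a < m" "b < m"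
  shows "frame_homotopy \<Xi> u (- k) a b =
    (\<Sum>c<m. eps c a * (\<Sum>d<m. eps d b * frame_homotopy \<Xi> u k d c))"
proof -
  have X: "\<Xi> c (s, - k) = (\<Sum>e<m. scaleC (eps e c) (\<theta> (\<Xi> e (- s, k))))" if "c < m" for c s
    using trs_frame_apply[OF symmetric that, of "(- s, k)"] by simp
  have x: "T (- k) s (\<xi> a (- k)) = (\<Sum>d<m. scaleC (eps d a) (\<theta> (T k (- s) (\<xi> d k))))" if "a < m" for a s
    by (simp add: trs_frame_apply[OF frame0_trs that] blinfun.sum_right T_scaleC T_theta_minus)
  have l: "cinner (T (- k) (- u) (\<xi> a (- k))) (\<Xi> c (- u, - k)) =
      (\<Sum>p<m. \<Sum>e<m. eps p a * eps e c * cinner (\<Xi> e (u, k)) (T k u (\<xi> p k)))" if "c < m" for c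
    unfolding X[OF that] x[OF ab(1)] cinner.sum_left
    by (intro sum.cong refl) (simp add: cinner.sum_right cinner_theta sum_distrib_left mult_ac)
  have r: "cinner (\<Xi> c (u, - k)) (T (- k) u (\<xi> b (- k))) =
      (\<Sum>d<m. \<Sum>f<m. eps d b * eps f c * cinner (T k (- u) (\<xi> d k)) (\<Xi> f (- u, k)))" if "c < m" for c
    unfolding X[OF that] x[OF ab(2)] cinner.sum_right
    by (intro sum.cong refl) (simp add: cinner.sum_left cinner_theta sum_distrib_left mult_ac)
  have contract: "(\<Sum>c<m. (\<Sum>e<m. eps e c * f e) * (\<Sum>e<m. eps e c * g e)) = (\<Sum>e<m. f e * g e)"
    for f g :: "nat \<Rightarrow> complex"
  proof -
    have "(\<Sum>c<m. (\<Sum>e<m. eps e c * f e) * (\<Sum>e'<m. eps e' c * g e'))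
        = (\<Sum>c<m. \<Sum>e<m. \<Sum>e'<m. f e * g e' * (eps e c * eps e' c))"
      unfolding sum_product by (simp only: mult_ac)
    also have "\<dots> = (\<Sum>e<m. \<Sum>e'<m. f e * g e' * (\<Sum>c<m. eps e c * eps e' c))"
      unfolding sum_distrib_left by (rule sum_rotate)
    also have "\<dots> = (\<Sum>e<m. \<Sum>e'<m. f e * ((if e = e' then 1 else 0) * g e'))"
      by (intro sum.cong refl) (simp add: eps_orthogonal')
    also have "\<dots> = (\<Sum>e<m. f e * g e)"
      by (intro sum.cong refl) (simp add: sum_delta_mult flip: sum_distrib_left)
    finally show ?thesis .
  qed
  have "frame_homotopy \<Xi> u (- k) a b = (\<Sum>c<m.
      (\<Sum>e<m. eps e c * (\<Sum>p<m. eps p a * cinner (\<Xi> e (u, k)) (T k u (\<xi> p k)))) *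
      (\<Sum>f<m. eps f c * (\<Sum>d<m. eps d b * cinner (T k (- u) (\<xi> d k)) (\<Xi> f (- u, k)))))"
    unfolding frame_homotopy_def
  proof (intro sum.cong refl arg_cong2[of _ _ _ _ "(*)"])
    fix c assume "c \<in> {..<m}"
    then have c: "c < m" by simp
    show "cinner (T (- k) (- u) (\<xi> a (- k))) (\<Xi> c (- u, - k)) =
      (\<Sum>e<m. eps e c * (\<Sum>p<m. eps p a * cinner (\<Xi> e (u, k)) (T k u (\<xi> p k))))"
      unfolding l[OF c] by (subst sum.swap) (simp add: sum_distrib_left mult_ac)
    show "cinner (\<Xi> c (u, - k)) (T (- k) u (\<xi> b (- k))) =
      (\<Sum>f<m. eps f c * (\<Sum>d<m. eps d b * cinner (T k (- u) (\<xi> d k)) (\<Xi> f (- u, k))))"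
      unfolding r[OF c] by (subst sum.swap) (simp add: sum_distrib_left mult_ac)
  qed
  also have "\<dots> = (\<Sum>e<m. (\<Sum>p<m. eps p a * cinner (\<Xi> e (u, k)) (T k u (\<xi> p k))) *
      (\<Sum>d<m. eps d b * cinner (T k (- u) (\<xi> d k)) (\<Xi> e (- u, k))))"
    by (rule contract)
  also have "\<dots> = (\<Sum>e<m. \<Sum>p<m. \<Sum>d<m. eps p a * (eps d b *
      (cinner (T k (- u) (\<xi> d k)) (\<Xi> e (- u, k)) * cinner (\<Xi> e (u, k)) (T k u (\<xi> p k)))))"
    unfolding sum_product by (simp only: mult_ac)
  also have "\<dots> = (\<Sum>p<m. \<Sum>d<m. \<Sum>e<m. eps p a * (eps d b *
      (cinner (T k (- u) (\<xi> d k)) (\<Xi> e (- u, k)) * cinner (\<Xi> e (u, k)) (T k u (\<xi> p k)))))"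
    by (rule sum_rotate)
  finally show ?thesis unfolding frame_homotopy_def sum_distrib_left .
qed

lemma frame_homotopy_matching: "matching_family eps m (frame_homotopy \<Xi> u)"
  unfolding matching_family_def
proof (intro conjI allI impI)
  fix a b assume ab: "a < m" "b < m"
  show "continuous_on UNIV (\<lambda>k. frame_homotopy \<Xi> u k a b)"
    by (intro continuous_on_frame_homotopy ab continuous_intros)
  show "periodic_d (\<lambda>k. frame_homotopy \<Xi> u k a b)"
    unfolding periodic_d_def frame_homotopy_def using ab frame_periodic[of _ 0]
    by (simp add: frame0_periodic T_periodic)
  show "(\<Sum>c<m. eps a c * frame_homotopy \<Xi> u k c b) = (\<Sum>c<m. frame_homotopy \<Xi> u (- k) c a * eps c b)" for k
    using matching_conj_iff[of "frame_homotopy \<Xi> u k" "frame_homotopy \<Xi> u (- k)"]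
      frame_homotopy_symmetric ab by blast
qed (rule unitary_frame_homotopy)

lemma frame_homotopy_start:
  assumes ab: "a < m" "b < m"
  shows "frame_homotopy \<Xi> 0 k a b = (if a = b then 1 else 0)"
  using onb_parseval[OF orth_proj_P onb_frame P_frame0[OF ab(2)], of "\<xi> a k" k]
    orthonormalD[OF frame0_orthonormal ab] by (simp add: frame_homotopy_def)

text \<open>At \<open>u = 1/2\<close> periodicity identifies \<open>\<Xi>(-1/2, k)\<close> with \<open>\<Xi>(1/2, k)\<close>, and the sum collapses
  by Parseval's identity.\<close>
lemma frame_homotopy_end:
  assumes ab: "a < m" "b < m"
  shows "frame_homotopy \<Xi> (1/2) k a b = transition k a b"
proof -
  have "\<Xi> c (- (1/2), k) = \<Xi> c (1/2, k)" if "c < m" for c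
    using frame_periodic[OF that, of 1 0 "- (1/2)" k] by simp
  then have "frame_homotopy \<Xi> (1/2) k a b =
      (\<Sum>c<m. cinner (T k (- (1/2)) (\<xi> a k)) (\<Xi> c (1/2, k)) * cinner (\<Xi> c (1/2, k)) (T k (1/2) (\<xi> b k)))"
    unfolding frame_homotopy_def by (intro sum.cong refl) simp
  also have "\<dots> = cinner (T k (- (1/2)) (\<xi> a k)) (T k (1/2) (\<xi> b k))"
    by (rule onb_parseval[OF orth_proj_P onb_frame P_T_frame0[OF ab(2)], symmetric])
  also have "T k (1/2) (\<xi> b k) = T k (- (1/2)) (T k 1 (\<xi> b k))"
    using T_shift[of 1 k "- (1/2)" "\<xi> b k"] by simp
  finally show ?thesis by (simp add: cinner_T transition_def)
qed

lemma frame_imp_null_homotopic: "equiv_null_homotopic eps m transition"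
  unfolding equiv_null_homotopic_def
\<comment> \<open>Time runs from u = 1/2, where the matrix is \<open>transition\<close>, down to u =
  0, where it is the identity.\<close>
proof (intro exI[of _ "\<lambda>t. frame_homotopy \<Xi> ((1 - t) / 2)"] conjI allI ballI impI)
  fix a b assume "a < m" "b < m"
  then show "continuous_on ({0..1} \<times> UNIV) (\<lambda>(t, k). frame_homotopy \<Xi> ((1 - t) / 2) k a b)"
    unfolding split_beta by (intro continuous_on_frame_homotopy continuous_intros) auto
qed (simp_all add: frame_homotopy_matching frame_homotopy_start frame_homotopy_end)

end

end

section \<open>From a homotopy to a frame\<close>

lemma norm_orthonormal_sum:
  fixes e f :: "nat \<Rightarrow> 'h::chilbert"
  assumes "orthonormal m e" "orthonormal m f"
  shows "norm (\<Sum>a<m. scaleC (c a) (e a)) = norm (\<Sum>a<m. scaleC (c a) (f a))"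
proof -
  have "complex_of_real ((norm (\<Sum>a<m. scaleC (c a) (g a)))\<^sup>2) = (\<Sum>a<m. cnj (c a) * c a)"
    if "orthonormal m g" for g :: "nat \<Rightarrow> 'h"
    unfolding cinner_self[symmetric] by (subst cinner.sum_left) (simp add: cinner_orthonormal_sum[OF that])
  from this[OF assms(1)] this[OF assms(2)]
  have "(norm (\<Sum>a<m. scaleC (c a) (e a)))\<^sup>2 = (norm (\<Sum>a<m. scaleC (c a) (f a)))\<^sup>2"
    by (metis of_real_eq_iff)
  then show ?thesis by simp
qed

context time_reversal_family
begin

section \<open>Matrices as operators on the Hilbert space\<close>

text \<open>\<open>\<Sum> A\<^sub>a\<^sub>b |\<xi>\<^sub>a\<rangle>\<langle>\<xi>\<^sub>b| + 1 - P(0, k)\<close>, with the complex bra \<open>\<langle>\<xi>\<^sub>b|\<close> split into its real and imaginary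
  parts, so that continuity in operator norm comes from bounded linear maps.\<close>
definition mat_op :: "real^'d \<Rightarrow> (nat \<Rightarrow> nat \<Rightarrow> complex) \<Rightarrow> 'h \<Rightarrow>\<^sub>L 'h" where
  "mat_op k A = (\<Sum>a<m. \<Sum>b<m.
      (blinfun_scaleR_left (scaleC (A a b) (\<xi> a k)) o\<^sub>L blinfun_inner_right (\<xi> b k)) +
      (blinfun_scaleR_left (iunit (scaleC (A a b) (\<xi> a k))) o\<^sub>L blinfun_inner_right (iunit (\<xi> b k)))) +
    (id_blinfun - P (0, k))"

lemma mat_op_apply:
  "mat_op k A x = (\<Sum>a<m. scaleC (\<Sum>b<m. A a b * cinner (\<xi> b k) x) (\<xi> a k)) + (x - P (0, k) x)"
proof -
  have "inner b x *\<^sub>R w + inner (iunit b) x *\<^sub>R iunit w = scaleC (cinner b x) w" for b w :: 'h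
    by (simp add: scaleC_def cinner_def inner_iunit_left)
  then show ?thesis
    by (simp add: mat_op_def blinfun.bilinear_simps blinfun.sum_left scaleC.sum_left mult.commute)
qed

lemma continuous_on_mat_op:
  assumes f: "\<And>a b. a < m \<Longrightarrow> b < m \<Longrightarrow> continuous_on S (\<lambda>x. f x a b)" and g: "continuous_on S g"
  shows "continuous_on S (\<lambda>x. mat_op (g x) (f x))"
proof -
  have P: "continuous_on UNIV P"
    using C1_deriv by (auto intro!: continuous_at_imp_continuous_on has_derivative_continuous)
  show ?thesis
    unfolding mat_op_def
    by (intro continuous_on_add continuous_on_sum continuous_on_diff continuous_on_blinfun_compose
        bounded_linear.continuous_on[OF bounded_linear_blinfun_scaleR_left]
        bounded_linear.continuous_on[OF bounded_linear_blinfun_inner_right]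
        bounded_linear.continuous_on[OF bounded_linear_iunit]
        continuous_on_scaleC f continuous_on_frame0 g continuous_on_const
        continuous_on_compose2[OF P] continuous_on_Pair) auto
qed

lemma cinner_frame0_P: "b < m \<Longrightarrow> cinner (\<xi> b k) (P (0, k) x) = cinner (\<xi> b k) x"
  using orth_projD(3)[OF orth_proj_P, of "(0, k)" "\<xi> b k" x] by simp

lemma P_mat_op: "P (0, k) (mat_op k A x) = mat_op k A (P (0, k) x)"
  by (simp add: mat_op_apply blinfun.bilinear_simps blinfun.sum_right scaleC_def P_iunit P_idem
      cinner_frame0_P)

lemma mat_op_iunit: "mat_op k A (iunit x) = iunit (mat_op k A x)"
proof -
  have "iunit (\<Sum>a<m. f a) = (\<Sum>a<m. iunit (f a))" for f :: "nat \<Rightarrow> 'h"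
    using linear_sum[OF bounded_linear.linear[OF bounded_linear_iunit]] by simp
  moreover have "scaleC (\<i> * c) y = iunit (scaleC c y)" for c and y :: 'h
    by (simp add: scaleC_def iunit_add iunit_scaleR iunit_iunit)
  ultimately show ?thesis
    by (simp add: mat_op_apply cinner_iunit_right P_iunit iunit_add iunit_diff
        mult.left_commute[of _ \<i>] flip: sum_distrib_left)
qed

lemma mat_op_scaleC: "mat_op k A (scaleC c x) = scaleC c (mat_op k A x)"
  by (simp add: scaleC_def blinfun.bilinear_simps mat_op_iunit)

lemma mat_op_frame0:
  assumes "b < m"
  shows "mat_op k A (\<xi> b k) = (\<Sum>a<m. scaleC (A a b) (\<xi> a k))"
proof -
  have "(\<Sum>c<m. A a c * cinner (\<xi> c k) (\<xi> b k)) = A a b" for a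
  proof -
    have "(\<Sum>c<m. A a c * cinner (\<xi> c k) (\<xi> b k)) = (\<Sum>c<m. A a c * (if c = b then 1 else 0))"
      using assms by (intro sum.cong refl) (simp add: orthonormalD[OF frame0_orthonormal])
    then show ?thesis by (simp only: sum_delta_mult(2)[OF assms])
  qed
  then show ?thesis using assms by (simp add: mat_op_apply)
qed

lemma mat_op_identity:
  assumes "\<And>a b. a < m \<Longrightarrow> b < m \<Longrightarrow> A a b = (if a = b then 1 else 0)"
  shows "mat_op k A = id_blinfun"
proof (rule blinfun_eqI)
  fix x
  have "(\<Sum>b<m. A a b * cinner (\<xi> b k) x) = cinner (\<xi> a k) x" if "a < m" for a
  proof -
    have "(\<Sum>b<m. A a b * cinner (\<xi> b k) x) = (\<Sum>b<m. (if a = b then 1 else 0) * cinner (\<xi> b k) x)"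
      using that by (intro sum.cong refl) (simp add: assms)
    then show ?thesis by (simp only: sum_delta_mult(1)[OF that])
  qed
  then show "mat_op k A x = id_blinfun x" by (simp add: mat_op_apply P0_expand)
qed

lemma mat_op_split: "mat_op k A x = mat_op k A (P (0, k) x) + (x - P (0, k) x)"
  by (simp add: mat_op_apply P_idem cinner_frame0_P)

text \<open>Unitarity carries the frame to an orthonormal family; Pythagoras adds the complement of
  the range, where the operator is the identity.\<close>

lemma norm_mat_op:
  assumes A: "unitary_mat m A"
  shows "norm (mat_op k A x) = norm x"
proof -
  have "orthonormal m (\<lambda>b. mat_op k A (\<xi> b k))"
    unfolding orthonormal_def
  proof (intro allI impI)
    fix a b assume ab: "a < m" "b < m"
    have "cinner (mat_op k A (\<xi> a k)) (mat_op k A (\<xi> b k)) = (\<Sum>c<m. cnj (A c a) * A c b)"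
      unfolding mat_op_frame0[OF ab(1)] mat_op_frame0[OF ab(2)]
      by (subst cinner.sum_left) (simp add: cinner_orthonormal_sum[OF frame0_orthonormal])
    then show "cinner (mat_op k A (\<xi> a k)) (mat_op k A (\<xi> b k)) = (if a = b then 1 else 0)"
      using A ab by (simp add: unitary_mat_def)
  qed
  from norm_orthonormal_sum[OF this frame0_orthonormal, of "\<lambda>b. cinner (\<xi> b k) x"]
  have n: "norm (mat_op k A (P (0, k) x)) = norm (P (0, k) x)"
    by (simp add: P0_expand blinfun.sum_right mat_op_scaleC)
  have pyth: "(norm (P (0, k) y + (x - P (0, k) x)))\<^sup>2 = (norm (P (0, k) y))\<^sup>2 + (norm (x - P (0, k) x))\<^sup>2" for y
  proof -
    have "inner (P (0, k) y) (x - P (0, k) x) = 0"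
      by (simp add: inner_P blinfun.bilinear_simps P_idem)
    then show ?thesis by (simp add: power2_norm_eq_inner inner_add_left inner_add_right inner_commute)
  qed
  have "(norm (mat_op k A x))\<^sup>2 = (norm (P (0, k) x))\<^sup>2 + (norm (x - P (0, k) x))\<^sup>2"
    using pyth[of "mat_op k A x"] unfolding P_mat_op mat_op_split[symmetric] n .
  also have "\<dots> = (norm x)\<^sup>2" using pyth[of x] by simp
  finally show ?thesis by simp
qed

section \<open>Time reversal as a real-linear operator\<close>

definition Theta :: "'h \<Rightarrow>\<^sub>L 'h" where
  "Theta = Blinfun \<theta>"

text \<open>The square of \<theta> is the scalar \<open>sgn_theta\<close>, itself of square 1, so
  this multiple of \<theta> is its inverse.\<close>

definition Theta_inv :: "'h \<Rightarrow>\<^sub>L 'h" where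
  "Theta_inv = sgn_theta *\<^sub>R Theta"

lemma Theta_apply [simp]: "Theta x = \<theta> x"
  by (simp add: Theta_def bounded_linear_Blinfun_apply bounded_linear_theta)

lemma Theta_inv_apply [simp]: "Theta_inv x = sgn_theta *\<^sub>R \<theta> x"
  by (simp add: Theta_inv_def blinfun.scaleR_left)

text \<open>Commuting with \<open>P(0, k)\<close> is encoded by the isometric reflection \<open>2 P(0, k) - 1\<close>, because the
  square root is only compatible with conjugation by isometries.\<close>
definition symmetries :: "real^'d \<Rightarrow> ('h \<Rightarrow>\<^sub>L 'h) set" where
  "symmetries k = {iunit_blinfun, 2 *\<^sub>R P (0, k) - id_blinfun}"

lemma norm_reflection: "norm (2 *\<^sub>R P (0, k) x - x) = norm x"
proof -
  have "inner (P (0, k) x) (P (0, k) x) = inner (P (0, k) x) x"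
    by (simp add: inner_P P_idem inner_commute)
  then show ?thesis
    by (simp add: norm_eq_sqrt_inner inner_diff_left inner_diff_right inner_commute)
qed

sublocale inv: involutive_conjugation Theta Theta_inv symmetries "{n. int_vec n}"
proof
  show "\<exists>R. Q o\<^sub>L R = id_blinfun \<and> R o\<^sub>L Q = id_blinfun" if Q: "Q \<in> symmetries k" for Q k
  proof -
    consider "Q = iunit_blinfun" | "Q = 2 *\<^sub>R P (0, k) - id_blinfun"
      using Q by (auto simp: symmetries_def)
    then show ?thesis
    proof cases
      case 1
      then show ?thesis
        by (intro exI[of _ "- iunit_blinfun"])
          (auto intro!: blinfun_eqI simp: blinfun.bilinear_simps iunit_iunit)
    next
      case 2
      then show ?thesis
        by (intro exI[of _ Q])
          (auto intro!: blinfun_eqI simp: blinfun.bilinear_simps P_idem scaleR_2)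
    qed
  qed
qed (auto simp: theta_scaleR theta_theta norm_theta blinfun.bilinear_simps symmetries_def norm_reflection
    int_vec_minus)

lemma admissible_commutes:
  assumes "inv.admissible V"
  shows "V (t, k) (iunit x) = iunit (V (t, k) x)" "V (t, k) (P (0, k) x) = P (0, k) (V (t, k) x)"
    "V (t, k) (scaleC c x) = scaleC c (V (t, k) x)"
proof -
  show i: "V (t, k) (iunit x) = iunit (V (t, k) x)" for x
    using inv.admissibleD(4)[OF assms, of iunit_blinfun k t x] by (simp add: symmetries_def)
  show "V (t, k) (P (0, k) x) = P (0, k) (V (t, k) x)"
    using inv.admissibleD(4)[OF assms, of "2 *\<^sub>R P (0, k) - id_blinfun" k t x]
    by (simp add: symmetries_def blinfun.bilinear_simps)
  show "V (t, k) (scaleC c x) = scaleC c (V (t, k) x)"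
    by (simp add: scaleC_def blinfun.bilinear_simps i)
qed

text \<open>In a time-reversal symmetric frame conjugation by \<open>\<theta>\<close> turns the matrix \<open>A\<close> into
  \<open>\<epsilon>\<^sup>t cnj(A) \<epsilon>\<close>, so this is the matching condition combined with unitarity.\<close>
lemma mat_op_conj_op:
  assumes A': "unitary_mat m A'"
    and match: "\<And>a b. a < m \<Longrightarrow> b < m \<Longrightarrow> (\<Sum>c<m. eps a c * A' c b) = (\<Sum>c<m. A c a * eps c b)"
  shows "mat_op k A o\<^sub>L inv.conj_op (mat_op (- k) A') = id_blinfun"
proof -
  \<comment> \<open>Two factors \<theta> make \<open>N\<close> complex-linear, so it suffices to
    test it on the frame and on the complement of the range.\<close>
  define N where "N x = mat_op k A (\<theta> (mat_op (- k) A' (sgn_theta *\<^sub>R \<theta> x)))" for x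
  have N_add: "N (x + y) = N x + N y" for x y
    by (simp add: N_def theta_add blinfun.bilinear_simps scaleR_add_right)
  have N_scaleC: "N (scaleC c x) = scaleC c (N x)" for c x
    by (simp add: N_def theta_scaleC mat_op_scaleC flip: scaleC_of_real) (simp add: mult.commute)
  have N_sum: "N (\<Sum>a<n. f a) = (\<Sum>a<n. N (f a))" for f and n :: nat
  proof (induction n)
    case 0
    show ?case using N_add[of 0 0] by simp
  qed (simp add: N_add)
  have cond: "A a b = (\<Sum>c<m. eps c a * (\<Sum>d<m. eps d b * A' d c))" if "a < m" "b < m" for a b
    using matching_conj_iff[of A' A] match that by blast
  \<comment> \<open>In matrix form: A \<epsilon>^t = \<epsilon>^t (A')^t.\<close>
  have L: "(\<Sum>d<m. eps a d * A e d) = (\<Sum>g<m. eps g e * A' a g)" if ae: "a < m" "e < m" for a e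
  proof -
    have "(\<Sum>d<m. eps a d * A e d) = (\<Sum>d<m. \<Sum>g<m. \<Sum>h<m. eps g e * (A' h g * (eps a d * eps h d)))"
      using ae by (intro sum.cong refl) (simp add: cond sum_distrib_left mult_ac)
    also have "\<dots> = (\<Sum>g<m. \<Sum>h<m. \<Sum>d<m. eps g e * (A' h g * (eps a d * eps h d)))"
      by (rule sum_rotate)
    also have "\<dots> = (\<Sum>g<m. eps g e * (\<Sum>h<m. A' h g * (\<Sum>d<m. eps a d * eps h d)))"
      by (simp only: sum_distrib_left)
    also have "\<dots> = (\<Sum>g<m. eps g e * (\<Sum>h<m. A' h g * (if h = a then 1 else 0)))"
      using ae by (intro sum.cong refl arg_cong2[of _ _ _ _ "(*)"]) (auto simp: eps_orthogonal')
    finally show ?thesis by (simp only: sum_delta_mult(2)[OF ae(1)])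
  qed
  have N_frame: "N (\<xi> b k) = \<xi> b k" if b: "b < m" for b
  proof -
    have 1: "sgn_theta *\<^sub>R \<theta> (\<xi> b k) = (\<Sum>c<m. scaleC (eps c b) (\<xi> c (- k)))"
      using theta_frame0[OF b, of "- k"]
      by (simp add: scaleC.sum_right flip: scaleC_of_real)
    have 2: "mat_op k A (\<theta> (\<xi> a (- k))) = (\<Sum>e<m. scaleC (\<Sum>g<m. eps g e * A' a g) (\<xi> e k))" if a: "a < m" for a
    proof -
      have "mat_op k A (\<theta> (\<xi> a (- k))) = (\<Sum>d<m. \<Sum>e<m. scaleC (eps a d * A e d) (\<xi> e k))"
        by (simp add: theta_frame0'[OF a] blinfun.sum_right mat_op_scaleC mat_op_frame0 scaleC.sum_right)
      also have "\<dots> = (\<Sum>e<m. scaleC (\<Sum>d<m. eps a d * A e d) (\<xi> e k))"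
        by (subst sum.swap) (simp add: scaleC.sum_left)
      also have "\<dots> = (\<Sum>e<m. scaleC (\<Sum>g<m. eps g e * A' a g) (\<xi> e k))"
        using a by (intro sum.cong refl) (simp add: L)
      finally show ?thesis .
    qed
    have "N (\<xi> b k) = (\<Sum>c<m. scaleC (eps c b) (\<Sum>a<m. scaleC (cnj (A' a c)) (mat_op k A (\<theta> (\<xi> a (- k))))))"
      unfolding N_def 1
      by (simp add: blinfun.sum_right mat_op_scaleC mat_op_frame0 theta_sum theta_scaleC)
    also have "\<dots> = (\<Sum>c<m. scaleC (eps c b) (\<Sum>e<m. scaleC (eps c e) (\<xi> e k)))"
    proof (rule sum.cong[OF refl], rule arg_cong2[of _ _ _ _ scaleC, OF refl])
      fix c assume "c \<in> {..<m}"
      then have c: "c < m" by simp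
      have "(\<Sum>a<m. scaleC (cnj (A' a c)) (mat_op k A (\<theta> (\<xi> a (- k))))) =
          (\<Sum>a<m. \<Sum>e<m. scaleC (cnj (A' a c) * (\<Sum>g<m. eps g e * A' a g)) (\<xi> e k))"
        by (intro sum.cong refl) (simp add: 2 scaleC.sum_right)
      also have "\<dots> = (\<Sum>e<m. scaleC (\<Sum>a<m. cnj (A' a c) * (\<Sum>g<m. eps g e * A' a g)) (\<xi> e k))"
        by (subst sum.swap) (simp add: scaleC.sum_left)
      also have "\<dots> = (\<Sum>e<m. scaleC (eps c e) (\<xi> e k))"
      proof (intro sum.cong refl arg_cong2[of _ _ _ _ scaleC])
        fix e
        have "(\<Sum>a<m. cnj (A' a c) * (\<Sum>g<m. eps g e * A' a g)) =
            (\<Sum>a<m. \<Sum>g<m. eps g e * (cnj (A' a c) * A' a g))"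
          by (simp add: sum_distrib_left mult_ac)
        also have "\<dots> = (\<Sum>g<m. eps g e * (\<Sum>a<m. cnj (A' a c) * A' a g))"
          by (subst sum.swap) (simp only: sum_distrib_left)
        also have "\<dots> = (\<Sum>g<m. eps g e * (if g = c then 1 else 0))"
          using A' c by (intro sum.cong refl) (auto simp: unitary_mat_def)
        finally show "(\<Sum>a<m. cnj (A' a c) * (\<Sum>g<m. eps g e * A' a g)) = eps c e"
          by (simp only: sum_delta_mult(2)[OF c])
      qed
      finally show "(\<Sum>a<m. scaleC (cnj (A' a c)) (mat_op k A (\<theta> (\<xi> a (- k))))) = (\<Sum>e<m. scaleC (eps c e) (\<xi> e k))" .
    qed
    also have "\<dots> = (\<Sum>e<m. scaleC (\<Sum>c<m. eps c b * eps c e) (\<xi> e k))"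
      by (simp add: scaleC.sum_right scaleC.sum_left) (rule sum.swap)
    also have "\<dots> = (\<Sum>e<m. if e = b then \<xi> e k else 0)"
      using b by (intro sum.cong refl) (auto simp: eps_orthogonal scaleC.zero_left)
    finally show ?thesis using b by simp
  qed
  have "N x = x" for x
  proof -
    let ?y = "x - P (0, k) x"
    \<comment> \<open>On the complement of the range both matrix operators act trivially, and the
      two factors \<theta> cancel against the sign.\<close>
    have fix0: "mat_op k' B z = z" if "P (0, k') z = 0" for k' B z
      using mat_op_split[of k' B z] that by simp
    have "P (0, - k) (sgn_theta *\<^sub>R \<theta> ?y) = sgn_theta *\<^sub>R \<theta> (P (0, k) ?y)"
      using trs[rule_format, of "(0, k)" ?y] by (simp add: blinfun.scaleR_right)
    also have "P (0, k) ?y = 0" by (simp add: blinfun.bilinear_simps P_idem)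
    finally have "N ?y = mat_op k A (\<theta> (sgn_theta *\<^sub>R \<theta> ?y))"
      using theta_scaleR[of 0 0] by (simp add: N_def fix0)
    also have "\<dots> = mat_op k A ?y" by (simp add: theta_scaleR theta_theta)
    also have "\<dots> = ?y" by (rule fix0) (simp add: blinfun.bilinear_simps P_idem)
    finally have y: "N ?y = ?y" .
    have "N (P (0, k) x) = P (0, k) x"
      by (simp add: P0_expand N_sum N_scaleC N_frame)
    then show ?thesis using y N_add[of "P (0, k) x" ?y] by simp
  qed
  then show ?thesis by (intro blinfun_eqI) (simp add: N_def inv.conj_op_def)
qed

end

section \<open>Folding the circle onto half a period\<close>

text \<open>The distance from \<open>s\<close> to the nearest integer.\<close>
definition circle_dist :: "real \<Rightarrow> real" where
  "circle_dist s = arccos (cos (2 * pi * s)) / (2 * pi)"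

lemma circle_dist_minus [simp]: "circle_dist (- s) = circle_dist s"
  by (simp add: circle_dist_def)

lemma sin_cos_2pi_shift:
  assumes "n \<in> \<int>"
  shows "sin (2 * pi * (s + n)) = sin (2 * pi * s)" "cos (2 * pi * (s + n)) = cos (2 * pi * s)"
proof -
  obtain i :: int where i: "n = of_int i" using assms by (auto elim: Ints_cases)
  have "\<exists>i::int. 2 * pi * (s + n) = 2 * pi * s + 2 * pi * of_int i"
    by (intro exI[of _ i]) (simp add: i algebra_simps)
  then have "sin (2 * pi * (s + n)) = sin (2 * pi * s) \<and> cos (2 * pi * (s + n)) = cos (2 * pi * s)"
    by (subst sin_cos_eq_iff)
  then show "sin (2 * pi * (s + n)) = sin (2 * pi * s)" "cos (2 * pi * (s + n)) = cos (2 * pi * s)"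
    by blast+
qed

lemma circle_dist_shift: "n \<in> \<int> \<Longrightarrow> circle_dist (s + n) = circle_dist s"
  by (simp add: circle_dist_def sin_cos_2pi_shift)

lemma continuous_on_circle_dist [continuous_intros]:
  fixes f :: "'a::t2_space \<Rightarrow> real"
  shows "continuous_on A f \<Longrightarrow> continuous_on A (\<lambda>x. circle_dist (f x))"
  unfolding circle_dist_def by (intro continuous_intros) auto

text \<open>\<open>arccos\<close> takes values in [0, \<pi>], where the sine is nonnegative; equal
  sine and cosine then determine the angle modulo a full turn.\<close>

lemma circle_dist_nonneg_sin:
  assumes "0 \<le> sin (2 * pi * s)"
  shows "\<exists>n\<in>\<int>. s = circle_dist s + n"
proof -
  let ?x = "arccos (cos (2 * pi * s))"
  have "sin ?x = sqrt (1 - (cos (2 * pi * s))\<^sup>2)" by (rule sin_arccos) auto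
  also have "\<dots> = sqrt ((sin (2 * pi * s))\<^sup>2)" by (simp only: sin_squared_eq)
  finally have "sin ?x = \<bar>sin (2 * pi * s)\<bar>" by simp
  then have "sin (2 * pi * s) = sin ?x \<and> cos (2 * pi * s) = cos ?x" using assms by simp
  then obtain i :: int where "2 * pi * s = ?x + 2 * pi * of_int i" unfolding sin_cos_eq_iff ..
  then have "s = circle_dist s + of_int i" by (simp add: circle_dist_def field_simps)
  then show ?thesis by (intro bexI[of _ "of_int i"]) auto
qed

lemma circle_dist_nonpos_sin:
  assumes "sin (2 * pi * s) \<le> 0"
  shows "\<exists>n\<in>\<int>. s = - circle_dist s + n"
proof -
  obtain n where "n \<in> \<int>" "- s = circle_dist (- s) + n"
    using circle_dist_nonneg_sin[of "- s"] assms by auto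
  then show ?thesis by (intro bexI[of _ "- n"]) auto
qed

lemma circle_dist_sin_zero:
  assumes "sin (2 * pi * s) = 0"
  shows "circle_dist s = 0 \<or> circle_dist s = 1/2"
proof -
  have "cos (2 * pi * s) = 1 \<or> cos (2 * pi * s) = - 1"
    using sin_cos_squared_add[of "2 * pi * s"] assms by (simp add: power2_eq_1_iff)
  then show ?thesis by (auto simp: circle_dist_def)
qed

text \<open>Clamping in time and subtracting the integer part of \<open>k\<close> move every pair
  into the compact set [0, 1] times the unit cell. The resulting \<open>N\<close> is the number of
  steps of the lifting.\<close>

lemma periodic_uniformly_close:
  fixes V :: "real \<times> (real^'d) \<Rightarrow> 'b::metric_space"
  assumes cont: "continuous_on UNIV V" and per: "\<And>t k n. int_vec n \<Longrightarrow> V (t, k + n) = V (t, k)"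
    and clamp: "\<And>t k. V (t, k) = V (max 0 (min 1 t), k)" and e: "e > 0"
  shows "\<exists>N>0. \<forall>s t k. \<bar>s - t\<bar> \<le> 1 / real N \<longrightarrow> dist (V (s, k)) (V (t, k)) \<le> e"
proof -
  have "uniformly_continuous_on ({0..1} \<times> cbox 0 1) V"
    by (intro compact_uniformly_continuous continuous_on_subset[OF cont] compact_Times) auto
  then obtain d where d: "d > 0" and uc: "\<And>p q. p \<in> {0..1} \<times> cbox 0 1 \<Longrightarrow> q \<in> {0..1} \<times> cbox 0 1 \<Longrightarrow>
      dist q p < d \<Longrightarrow> dist (V q) (V p) < e"
    unfolding uniformly_continuous_on_def using e by meson
  obtain N where N: "N > 0" "1 / real N < d"
    using real_arch_inverse[of d] d by (auto simp: inverse_eq_divide)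
  have "dist (V (s, k)) (V (t, k)) \<le> e" if st: "\<bar>s - t\<bar> \<le> 1 / real N" for s t k
  proof -
    define n :: "real^'d" where "n = (\<chi> i. of_int \<lfloor>k $ i\<rfloor>)"
    have n: "int_vec n" by (simp add: int_vec_def n_def)
    have box: "k - n \<in> cbox 0 1"
      unfolding mem_box_cart by (auto simp: n_def) linarith
    have V: "V (r, k) = V (max 0 (min 1 r), k - n)" for r
      using per[OF n, of _ "k - n"] clamp by simp
    have "dist (max 0 (min 1 s), k - n) (max 0 (min 1 t), k - n) < d"
      using st N(2) by (simp add: dist_Pair_Pair dist_real_def)
    then show ?thesis unfolding V[of s] V[of t]
      by (intro less_imp_le uc) (use box in auto)
  qed
  then show ?thesis using N(1) by blast
qed

context time_reversal_family
begin

section \<open>Lifting the homotopy and assembling the frame\<close>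

lemma mat_op_cong:
  assumes "\<And>a b. a < m \<Longrightarrow> b < m \<Longrightarrow> A a b = B a b" "int_vec n"
  shows "mat_op (k + n) A = mat_op k B"
proof -
  have "P (0, k + n) = P (0, k)" using P_periodic[of 0 n 0 k] assms(2) by simp
  then show ?thesis by (simp add: mat_op_def assms frame0_periodic)
qed

lemma mat_op_transition:
  assumes "P (0, k) y = y"
  shows "mat_op k (transition k) y = T k 1 y"
proof -
  have "mat_op k (transition k) (\<xi> b k) = T k 1 (\<xi> b k)" if b: "b < m" for b
  proof -
    have "mat_op k (transition k) (\<xi> b k) = P (0, k) (T k 1 (\<xi> b k))"
      by (simp add: mat_op_frame0[OF b] transition_def P0_expand)
    also have "\<dots> = T k 1 (\<xi> b k)"
      using P_T_frame0[OF b, of 1 k] P_shift[of 1 0 k] by simp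
    finally show ?thesis .
  qed
  then have "mat_op k (transition k) (P (0, k) y) = T k 1 (P (0, k) y)"
    by (simp add: P0_expand blinfun.sum_right mat_op_scaleC T_scaleC)
  then show ?thesis by (simp only: assms)
qed

lemma null_homotopic_imp_lift:
  assumes "equiv_null_homotopic eps m transition"
  shows "\<exists>\<delta> \<gamma>. inv.admissible \<delta> \<and> inv.admissible \<gamma> \<and> (\<forall>p. \<gamma> p = inv.conj_op (\<delta> (inv.flip p)))
    \<and> (\<forall>k. \<gamma> (0, k) = \<delta> (0, k))
    \<and> (\<forall>k x. P (0, k) x = x \<longrightarrow> T k 1 (\<delta> (1, k) x) = \<gamma> (1, k) x)"
proof -
  obtain H :: "real \<Rightarrow> real^'d \<Rightarrow> nat \<Rightarrow> nat \<Rightarrow> complex"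
    where cont: "\<And>a b. a < m \<Longrightarrow> b < m \<Longrightarrow> continuous_on ({0..1} \<times> UNIV) (\<lambda>(t, k). H t k a b)"
    and match: "\<And>t. t \<in> {0..1} \<Longrightarrow> matching_family eps m (H t)"
    and ends: "\<And>k a b. a < m \<Longrightarrow> b < m \<Longrightarrow> H 0 k a b = transition k a b"
      "\<And>k a b. a < m \<Longrightarrow> b < m \<Longrightarrow> H 1 k a b = (if a = b then 1 else 0)"
    using assms unfolding equiv_null_homotopic_def by blast
  \<comment> \<open>The homotopy starts at \<alpha>, whereas the lifting needs a path that starts at
    the identity, hence the reversal of time; clamping extends the path to all real times.\<close>
  define r where "r t = 1 - max 0 (min 1 t)" for t :: real
  have r: "r t \<in> {0..1}" for t by (auto simp: r_def)
  note match = match[OF r]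
  define V where "V p = mat_op (snd p) (H (r (fst p)) (snd p))" for p
  have V_cont: "continuous_on UNIV V"
    unfolding V_def
  proof (rule continuous_on_mat_op)
    fix a b assume ab: "a < m" "b < m"
    have *: "continuous_on UNIV (\<lambda>p. (r (fst p), snd p :: real^'d))"
      unfolding r_def by (intro continuous_intros)
    show "continuous_on UNIV (\<lambda>p. H (r (fst p)) (snd p) a b)"
      using continuous_on_compose2[OF cont[OF ab] *] r by (simp add: image_subset_iff)
  qed (intro continuous_intros)
  have V_per: "V (t, k + n) = V (t, k)" if "int_vec n" for t k n
    unfolding V_def fst_conv snd_conv
    by (rule mat_op_cong[OF _ that]) (use match that in \<open>auto simp: matching_family_def periodic_d_def\<close>)
  have V: "inv.admissible V"
    unfolding inv.admissible_def
  proof (intro conjI allI impI)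
    show "norm (V p x) = norm x" for p x
      unfolding V_def by (rule norm_mat_op) (use match in \<open>auto simp: matching_family_def\<close>)
    show "V (t, k) (Q x) = Q (V (t, k) x)" if "Q \<in> symmetries k" for t k Q x
      using that by (auto simp: V_def symmetries_def mat_op_iunit P_mat_op blinfun.bilinear_simps)
  qed (use V_cont V_per in auto)
  have inverse: "V p o\<^sub>L inv.conj_op (V (inv.flip p)) = id_blinfun" for p
    unfolding V_def inv.flip_def fst_conv snd_conv
  proof (rule mat_op_conj_op)
    show "unitary_mat m (H (r (fst p)) (- snd p))"
      using match unfolding matching_family_def by blast
    show "(\<Sum>c<m. eps a c * H (r (fst p)) (- snd p) c b) = (\<Sum>c<m. H (r (fst p)) (snd p) c a * eps c b)"
      if "a < m" "b < m" for a b
    proof -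
      have "(\<Sum>c<m. eps a c * H (r (fst p)) (- snd p) c b) = (\<Sum>c<m. H (r (fst p)) (- (- snd p)) c a * eps c b)"
        using match[of "fst p"] that unfolding matching_family_def by blast
      then show ?thesis by simp
    qed
  qed
  have start: "V (t, k) = id_blinfun" if "t \<le> 0" for t k
    using that by (auto simp: V_def r_def ends intro!: mat_op_identity)
  obtain N where N: "N > 0" "\<And>s t k. \<bar>s - t\<bar> \<le> 1 / real N \<Longrightarrow> dist (V (s, k)) (V (t, k)) \<le> 1/2"
    using periodic_uniformly_close[of V "1/2", OF V_cont V_per] by (auto simp: V_def r_def)
  obtain \<delta> where \<delta>: "inv.lifts (\<lambda>p. V (min (fst p) 1, snd p)) \<delta>"
    using inv.lifts_exists[OF V inverse start _ N(1)] N(2) by (auto simp: dist_norm)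
  \<comment> \<open>The path is constant after time 1, so clamping there changes nothing.\<close>
  have V1: "V (min (fst p) 1, snd p) = V p" for p by (simp add: V_def r_def min.commute)
  define \<gamma> where "\<gamma> p = inv.conj_op (\<delta> (inv.flip p))" for p
  have ad: "inv.admissible \<delta>" and lift: "V p o\<^sub>L \<delta> p = \<gamma> p" for p
    using \<delta> unfolding inv.lifts_def V1 \<gamma>_def by blast+
  have "inv.admissible \<gamma>"
    using inv.admissible_compose[OF V ad] by (simp add: lift)
  moreover have "\<gamma> (0, k) = \<delta> (0, k)" for k
    by (rule blinfun_eqI) (simp add: start flip: lift)
  moreover have "T k 1 (\<delta> (1, k) x) = \<gamma> (1, k) x" if "P (0, k) x = x" for k x
  proof -
    have "V (1, k) = mat_op k (transition k)"
      using mat_op_cong[of "H 0 k" "transition k" 0 k] by (simp add: V_def r_def ends)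
    moreover have "P (0, k) (\<delta> (1, k) x) = \<delta> (1, k) x"
      using admissible_commutes(2)[OF ad, of 1 k x] that by simp
    ultimately show ?thesis by (simp add: mat_op_transition flip: lift)
  qed
  ultimately show ?thesis using ad \<gamma>_def by blast
qed

text \<open>The frame is transported from \<open>k\<^sub>1 = 0\<close> to \<open>k\<^sub>1 = 1/2\<close> with \<open>\<delta>\<close>, and to \<open>k\<^sub>1 = -1/2\<close>
  with the reflected family \<open>\<gamma>\<close>; the sign of \<open>sin (2 \<pi> s)\<close> selects the branch modulo \<open>1\<close>.\<close>
lemma null_homotopic_imp_frame:
  assumes "equiv_null_homotopic eps m transition"
  shows "\<exists>\<Xi>. bloch_frame P m \<Xi> \<and> frame_continuous m \<Xi> \<and> (\<forall>a<m. periodic_D (\<Xi> a)) \<and> trs_frame \<theta> m \<Xi>"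
proof -
  obtain \<delta> \<gamma> where \<delta>: "inv.admissible \<delta>" and \<gamma>: "inv.admissible \<gamma>"
    and \<gamma>_conj: "\<And>p. \<gamma> p = inv.conj_op (\<delta> (inv.flip p))"
    and at0: "\<And>k. \<gamma> (0, k) = \<delta> (0, k)"
    and at1: "\<And>k x. P (0, k) x = x \<Longrightarrow> T k 1 (\<delta> (1, k) x) = \<gamma> (1, k) x"
    using null_homotopic_imp_lift[OF assms] by blast
  define F where "F a u k = T k u (\<delta> (2 * u, k) (\<xi> a k))" for a u k
  define G where "G a u k = T k (- u) (\<gamma> (2 * u, k) (\<xi> a k))" for a u k
  define \<Xi> where "\<Xi> a q = (if sin (2 * pi * fst q) \<le> 0
    then G a (circle_dist (fst q)) (snd q) else F a (circle_dist (fst q)) (snd q))" for a q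
  have FG: "F a u k = G a u k" if a: "a < m" and u: "u = 0 \<or> u = 1/2" for a u k
    using u
  proof
    assume u: "u = 1/2"
    \<comment> \<open>At u = 1/2 the branches agree because the lift at time 1 satisfies T(1)
      \<delta> = \<gamma> on the range.\<close>
    have "T k (1/2) x = T k (- (1/2)) (T k 1 x)" for x
      using T_shift[of 1 k "- (1/2)" x] by simp
    then show ?thesis using at1[of k "\<xi> a k"] a unfolding u F_def G_def by simp
  qed (simp add: F_def G_def at0)
  have junction: "G a (circle_dist s) k = F a (circle_dist s) k" if "a < m" "sin (2 * pi * s) = 0" for a s k
    using FG[OF that(1) circle_dist_sin_zero[OF that(2)]] by simp
  have cinner_adm: "cinner (X p x) (X p y) = cinner x y" if "inv.admissible X" for X p x y
  proof -
    have "X p (iunit y) = iunit (X p y)" using admissible_commutes(1)[OF that, of "fst p" "snd p" y] by simp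
    then show ?thesis
      using blinfun_isometry_inner[of "X p", OF inv.admissibleD(2)[OF that]]
      by (simp add: cinner_def) (metis)
  qed
  have on: "orthonormal m (\<lambda>a. F a u k)" "orthonormal m (\<lambda>a. G a u k)" for u k
    using frame0_orthonormal[of k]
    by (simp_all add: orthonormal_def F_def G_def cinner_T cinner_adm \<delta> \<gamma>)
  have PF: "P (u, k) (F a u k) = F a u k" and PG: "P (- u, k) (G a u k) = G a u k" if "a < m" for a u k
    using that by (simp_all add: F_def G_def T_intertwines flip: admissible_commutes(2)[OF \<delta>]
        admissible_commutes(2)[OF \<gamma>])
  have theta_\<delta>: "\<theta> (\<delta> (t, k) x) = \<gamma> (t, - k) (\<theta> x)" for t k x
    by (simp add: \<gamma>_conj inv.conj_op_def inv.flip_def theta_theta)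
  have theta_\<gamma>: "\<theta> (\<gamma> (t, k) x) = \<delta> (t, - k) (\<theta> x)" for t k x
    by (simp add: \<gamma>_conj inv.conj_op_def inv.flip_def theta_theta theta_scaleR blinfun.scaleR_right)
  have trsF: "F b u (- k) = (\<Sum>a<m. scaleC (eps a b) (\<theta> (G a u k)))"
    and trsG: "G b u (- k) = (\<Sum>a<m. scaleC (eps a b) (\<theta> (F a u k)))" if "b < m" for b u k
    by (simp_all add: F_def G_def trs_frame_apply[OF frame0_trs that] blinfun.sum_right T_scaleC
        admissible_commutes(3)[OF \<delta>] admissible_commutes(3)[OF \<gamma>] T_theta theta_\<delta> theta_\<gamma>)
  have "bloch_frame P m \<Xi>"
    unfolding bloch_frame_def
  proof
    fix q :: "real \<times> (real^'d)"
    obtain s k where q: "q = (s, k)" by force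
    obtain f where f: "onb_of_range (P q) m f" using rank unfolding rank_proj_def by blast
    show "onb_of_range (P q) m (\<lambda>a. \<Xi> a q)"
    proof (rule onb_of_rangeI[OF orth_proj_P f])
      show "orthonormal m (\<lambda>a. \<Xi> a q)"
        unfolding \<Xi>_def by (cases "sin (2 * pi * fst q) \<le> 0") (simp_all add: on)
    next
      fix a assume a: "a < m"
      show "P q (\<Xi> a q) = \<Xi> a q"
      proof (cases "sin (2 * pi * s) \<le> 0")
        case True
        then obtain n where "n \<in> \<int>" "s = - circle_dist s + n" using circle_dist_nonpos_sin by blast
        then have "P (s, k) = P (- circle_dist s, k)" by (metis P_shift)
        then show ?thesis using True PG[OF a] by (simp add: q \<Xi>_def)
      next
        case False
        then obtain n where "n \<in> \<int>" "s = circle_dist s + n" using circle_dist_nonneg_sin[of s] by auto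
        then have "P (s, k) = P (circle_dist s, k)" by (metis P_shift)
        then show ?thesis using False PF[OF a] by (simp add: q \<Xi>_def)
      qed
    qed
  qed
  moreover have "frame_continuous m \<Xi>"
    unfolding frame_continuous_def \<Xi>_def
  proof (intro allI impI continuous_on_cases_le)
    fix a assume a: "a < m"
    show "continuous_on {q \<in> UNIV. sin (2 * pi * fst q) \<le> 0} (\<lambda>q. G a (circle_dist (fst q)) (snd q))"
      unfolding G_def using a
      by (intro continuous_intros continuous_on_compose2[OF inv.admissibleD(1)[OF \<gamma>]]) auto
    show "continuous_on {q \<in> UNIV. 0 \<le> sin (2 * pi * fst q)} (\<lambda>q. F a (circle_dist (fst q)) (snd q))"
      unfolding F_def using a
      by (intro continuous_intros continuous_on_compose2[OF inv.admissibleD(1)[OF \<delta>]]) auto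
    show "G a (circle_dist (fst q)) (snd q) = F a (circle_dist (fst q)) (snd q)"
      if "sin (2 * pi * fst q) = 0" for q :: "real \<times> (real^'d)"
      using junction[OF a that] .
  qed (intro continuous_intros)
  moreover have "\<forall>a<m. periodic_D (\<Xi> a)"
  proof (intro allI impI)
    fix a assume a: "a < m"
    have "F a u (k + n) = F a u k \<and> G a u (k + n) = G a u k" if "int_vec n" for u k n
      using that inv.admissibleD(3)[OF \<delta>] inv.admissibleD(3)[OF \<gamma>]
      by (simp add: F_def G_def frame0_periodic[OF a] T_periodic)
    then show "periodic_D (\<Xi> a)"
      by (simp add: periodic_D_def \<Xi>_def circle_dist_shift sin_cos_2pi_shift)
  qed
  moreover have "trs_frame \<theta> m \<Xi>"
    unfolding trs_frame_def eps_def[symmetric]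
  proof (intro allI impI)
    fix b and q :: "real \<times> (real^'d)" assume b: "b < m"
    obtain s k where q: "q = (s, k)" by force
    let ?u = "circle_dist s"
    consider "sin (2 * pi * s) < 0" | "sin (2 * pi * s) > 0" | "sin (2 * pi * s) = 0" by linarith
    then show "\<Xi> b (- q) = (\<Sum>a<m. scaleC (eps a b) (\<theta> (\<Xi> a q)))"
    proof cases
      case 3
      \<comment> \<open>Here \<open>q\<close> and \<open>- q\<close> both select the branch
        \<open>G\<close>, while \<theta> exchanges \<open>G\<close> and \<open>F\<close>; the
        agreement at the junction bridges this.\<close>
      then show ?thesis using b by (simp add: q \<Xi>_def trsG junction)
    qed (simp_all add: q \<Xi>_def trsF[OF b] trsG[OF b])
  qed
  ultimately show ?thesis by blast
qed

end

theorem theorem2p6: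
  fixes P :: "real \<times> (real^'d) \<Rightarrow> ('h::chilbert \<Rightarrow>\<^sub>L 'h)"
    and P' :: "real \<times> (real^'d) \<Rightarrow> (real \<times> (real^'d)) \<Rightarrow>\<^sub>L ('h \<Rightarrow>\<^sub>L 'h)"
    and \<theta> :: "'h \<Rightarrow> 'h"
    and m :: nat
    and \<xi> :: "nat \<Rightarrow> real^'d \<Rightarrow> 'h"
    and T :: "real^'d \<Rightarrow> real \<Rightarrow> ('h \<Rightarrow>\<^sub>L 'h)"
  assumes rank: "\<forall>q. rank_proj (P q) m"
    and C1_deriv: "\<forall>q. (P has_derivative blinfun_apply (P' q)) (at q)"
    and C1_cont: "continuous_on UNIV P'"
    and per: "periodic_D P"
    and anti: "antiunitary \<theta>"
    and theta_sq: "(\<forall>x. \<theta> (\<theta> x) = x) \<or> (\<forall>x. \<theta> (\<theta> x) = - x)"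
    and trs: "\<forall>q x. \<theta> (blinfun_apply (P q) x) = blinfun_apply (P (- q)) (\<theta> x)"
    and frame0: "bloch_frame (\<lambda>k. P (0, k)) m \<xi>"
    and frame0_smooth: "\<forall>a<m. smooth_map (\<xi> a)"
    and frame0_per: "\<forall>a<m. periodic_d (\<xi> a)"
    and frame0_trs: "trs_frame \<theta> m \<xi>"
    and T0: "\<forall>k. T k 0 = id_blinfun"
    and T_ode: "\<forall>k s. (T k has_vector_derivative
          (((blinfun_apply (P' (s, k)) (1, 0) o\<^sub>L P (s, k)) - (P (s, k) o\<^sub>L blinfun_apply (P' (s, k)) (1, 0)))
            o\<^sub>L T k s)) (at s)"
  shows "matching_family (eps_mat (fermionic \<theta>) m) m
           (\<lambda>k a b. cinner (\<xi> a k) (blinfun_apply (T k 1) (\<xi> b k)))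
       \<and> (equiv_null_homotopic (eps_mat (fermionic \<theta>) m) m
           (\<lambda>k a b. cinner (\<xi> a k) (blinfun_apply (T k 1) (\<xi> b k)))
          \<longleftrightarrow> (\<exists>\<Xi> :: nat \<Rightarrow> real \<times> (real^'d) \<Rightarrow> 'h.
                 bloch_frame P m \<Xi> \<and> frame_continuous m \<Xi>
                 \<and> (\<forall>a<m. periodic_D (\<Xi> a)) \<and> trs_frame \<theta> m \<Xi>))"
proof -
  interpret time_reversal_family P P' \<theta> m \<xi> T
  proof unfold_locales
    \<comment> \<open>The empty list of directions in \<open>smooth_map\<close> gives continuity of
      the frame itself.\<close>
    show "\<forall>a<m. continuous_on UNIV (\<xi> a)"
      using frame0_smooth unfolding smooth_map_def by (metis iter_dir_deriv.simps(1))
  qed (fact assms)+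
  have "(\<lambda>k a b. cinner (\<xi> a k) (blinfun_apply (T k 1) (\<xi> b k))) = transition"
    by (simp add: transition_def fun_eq_iff)
  then show ?thesis
    using transition_matching frame_imp_null_homotopic null_homotopic_imp_frame
    unfolding eps_def by auto
qed

end
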